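(* Let $G$ be a finite connected simple graph. The connected subgraph arrangement $\mathcal{A}_G$ is factored if and only if $G$ is a path graph or is isomorphic to a path-with-triangle graph $\Delta_{n,1}$ for some $n\ge 2$.
   Context: For a finite simple graph $G=(N,E)$ with $N=\{1,\dots,n\}$ and $I\subseteq N$, $G[I]$ denotes the induced subgraph on $I$, and $H_I=\ker\big(\sum_{i\in I}x_i\big)$, where $x_1,\dots,x_n$ are the coordinate functions. The connected subgraph arrangement of $G$ is $\mathcal{A}_G=\{H_I:\emptyset\neq I\subseteq N,\ G[I]\text{ connected}\}$ over $\mathbb{Q}$. The path graph $P_m$ has vertices $1,\dots,m$ and edges $\{i,i+1\}$. $\Delta_{n,1}$ has vertices $1,\dots,n+1$ and edges $\{i,i+1\}$ ($1\le i<n$), $\{1,n+1\}$, $\{2,n+1\}$ (so $\Delta_{2,1}$ is a triangle). A partition $\pi=(\pi_1,\dots,\pi_s)$ of an arrangement $\mathcal{A}$ is nice if (i) for every choice $H_i\in\pi_i$ the $s$ defining forms are linearly independent, and (ii) for every $X\in L(\mathcal{A})\setminus\{V\}$ the induced partition of $\mathcal{A}_X=\{H\in\mathcal{A}:X\subseteq H\}$ into the nonempty sets $\pi_i\cap\mathcal{A}_X$ has a singleton block. $\mathcal{A}$ is factored if it admits a nice partition. *)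

theory Defs
  imports Complex_Main
begin

(* Graphs on vertex set {1..n}; edges are 2-element subsets. *)
definition simple_graph :: "nat \<Rightarrow> nat set set \<Rightarrow> bool" where
  "simple_graph n E \<longleftrightarrow>
     (\<forall>e\<in>E. \<exists>a b. e = {a, b} \<and> a \<noteq> b \<and> a \<in> {1..n} \<and> b \<in> {1..n})"

(* the induced subgraph G[I] is connected (and nonempty) *)
definition induced_connected :: "nat set set \<Rightarrow> nat set \<Rightarrow> bool" where
  "induced_connected E I \<longleftrightarrow> I \<noteq> {} \<and>
     (\<forall>u\<in>I. \<forall>v\<in>I. (u, v) \<in> ({(a, b). a \<in> I \<and> b \<in> I \<and> {a, b} \<in> E})\<^sup>*)"

definition graph_iso :: "nat \<Rightarrow> nat set set \<Rightarrow> nat \<Rightarrow> nat set set \<Rightarrow> bool" where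
  "graph_iso n E m F \<longleftrightarrow> (\<exists>f. bij_betw f {1..n} {1..m} \<and>
     (\<forall>a\<in>{1..n}. \<forall>b\<in>{1..n}. {a, b} \<in> E \<longleftrightarrow> {f a, f b} \<in> F))"

definition path_edges :: "nat \<Rightarrow> nat set set" where
  "path_edges m = {{i, i + 1} | i. 1 \<le> i \<and> i < m}"

(* Delta_{k,1}: vertices 1..k+1 *)
definition delta_edges :: "nat \<Rightarrow> nat set set" where
  "delta_edges k = {{i, i + 1} | i. 1 \<le> i \<and> i < k} \<union> {{1, k + 1}, {2, k + 1}}"

(* ambient space V = Q^n, vectors as functions supported on {1..n} *)
definition vspace :: "nat \<Rightarrow> (nat \<Rightarrow> rat) set" where
  "vspace n = {v. \<forall>i. i \<notin> {1..n} \<longrightarrow> v i = 0}"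

(* kernel of the linear form with coefficient vector f *)
definition kernel_of :: "nat \<Rightarrow> (nat \<Rightarrow> rat) \<Rightarrow> (nat \<Rightarrow> rat) set" where
  "kernel_of n f = {v \<in> vspace n. (\<Sum>i\<in>{1..n}. f i * v i) = 0}"

(* f is a defining form of hyperplane H *)
definition defining_form :: "nat \<Rightarrow> (nat \<Rightarrow> rat) set \<Rightarrow> (nat \<Rightarrow> rat) \<Rightarrow> bool" where
  "defining_form n H f \<longleftrightarrow> f \<in> vspace n \<and> f \<noteq> (\<lambda>_. 0) \<and> H = kernel_of n f"

(* H_I = ker(sum_{i in I} x_i) *)
definition hypI :: "nat \<Rightarrow> nat set \<Rightarrow> (nat \<Rightarrow> rat) set" where
  "hypI n I = kernel_of n (\<lambda>i. if i \<in> I then 1 else 0)"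

definition conn_subgraph_arr :: "nat \<Rightarrow> nat set set \<Rightarrow> (nat \<Rightarrow> rat) set set" where
  "conn_subgraph_arr n E = {hypI n I | I. I \<subseteq> {1..n} \<and> I \<noteq> {} \<and> induced_connected E I}"

(* intersection lattice L(A); the empty intersection is V *)
definition int_lattice :: "nat \<Rightarrow> (nat \<Rightarrow> rat) set set \<Rightarrow> (nat \<Rightarrow> rat) set set" where
  "int_lattice n A = {vspace n \<inter> \<Inter> B | B. B \<subseteq> A}"

definition localization :: "(nat \<Rightarrow> rat) set set \<Rightarrow> (nat \<Rightarrow> rat) set \<Rightarrow> (nat \<Rightarrow> rat) set set" where
  "localization A X = {H \<in> A. X \<subseteq> H}"

(* a partition of A into nonempty, pairwise disjoint blocks *)
definition is_partition :: "'a set \<Rightarrow> 'a set list \<Rightarrow> bool" where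
  "is_partition A P \<longleftrightarrow> (\<forall>i<length P. P ! i \<noteq> {}) \<and>
     (\<forall>i<length P. \<forall>j<length P. i \<noteq> j \<longrightarrow> P ! i \<inter> P ! j = {}) \<and>
     \<Union> (set P) = A"

definition forms_lin_indep :: "nat \<Rightarrow> nat \<Rightarrow> (nat \<Rightarrow> nat \<Rightarrow> rat) \<Rightarrow> bool" where
  "forms_lin_indep n s f \<longleftrightarrow>
     (\<forall>c :: nat \<Rightarrow> rat. (\<forall>j\<in>{1..n}. (\<Sum>i<s. c i * f i j) = 0) \<longrightarrow> (\<forall>i<s. c i = 0))"

definition nice_partition :: "nat \<Rightarrow> (nat \<Rightarrow> rat) set set \<Rightarrow> (nat \<Rightarrow> rat) set set list \<Rightarrow> bool" where
  "nice_partition n A P \<longleftrightarrow> is_partition A P \<and>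
     (\<forall>h f. (\<forall>i<length P. h i \<in> P ! i \<and> defining_form n (h i) (f i))
            \<longrightarrow> forms_lin_indep n (length P) f) \<and>
     (\<forall>X \<in> int_lattice n A - {vspace n}.
        \<exists>i<length P. card (P ! i \<inter> localization A X) = 1)"

definition factored :: "nat \<Rightarrow> (nat \<Rightarrow> rat) set set \<Rightarrow> bool" where
  "factored n A \<longleftrightarrow> (\<exists>P. nice_partition n A P)"

end

theory Submission
  imports Defs
begin

text \<open>
  If the arrangement is factored, colour each connected set by the block of its hyperplane. The flats
  of rank two alone force crossing sets to have different colours, and constrain three connected sets
  \<open>A\<close>, \<open>B\<close>, \<open>A \<union> B\<close> with \<open>A \<inter> B = {}\<close> to carry exactly two colours. Unions of disjoint connected
  parts inherit these constraints, so an induced minor obstructs a factorization as soon as its own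
  colouring problem has no solution; this happens for the claw, for every graph on a 4-cycle and for
  the butterfly. Adding one vertex at a time, the connected graphs without these minors are the paths
  and the graphs \<open>\<Delta>\<^bsub>k,1\<^esub>\<close>.

  Conversely, the intervals of a path are grouped by their right end point. For \<open>\<Delta>\<^bsub>k,1\<^esub>\<close> with extra
  vertex \<open>t\<close> a nice partition has the blocks \<open>{1,t}\<close> alone, \<open>{t}\<close> together with all initial intervals, and,
  for each \<open>b \<ge> 2\<close>, the remaining sets whose largest path vertex is \<open>b\<close>.
\<close>

section \<open>Connected vertex sets\<close>

text \<open>A rank-two flat through H_I and H_J lies in at most one further hyperplane of the
  arrangement, and only if \<open>I\<close> and \<open>J\<close> are disjoint (then for their union)
  or nested (then for their difference). With two hyperplanes the singleton block forces two
  colours; with three, the singleton block excludes a single colour and the linear relation between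
  the forms excludes three. For the converse the guide is the passage to prefix sums s_b = x_1 + ...
  + x_b. There the path gives the braid arrangement, all differences of s_0 = 0, s_1, ..., s_m,
  grouped by the larger index. The triangle adds two values u and w = s_1 + u, and s_1 - w, u - w
  are again u and s_1 up to sign. These coincidences are the obstacle: the first block that is hit
  may be hit twice, so the singleton must sometimes be sought in another block. Moreover no vertex
  lies in all sets of the block containing \<open>{t}\<close> and the initial intervals, so linear
  independence is not read off from a triangular shape alone; that block is isolated by evaluating
  at a common zero of the other chosen forms.\<close>

definition adjacent :: "nat set set \<Rightarrow> nat set \<Rightarrow> nat set \<Rightarrow> bool" where
  "adjacent E A B \<longleftrightarrow> (\<exists>a\<in>A. \<exists>b\<in>B. {a, b} \<in> E)"

lemma adjacent_commute: "adjacent E A B \<longleftrightarrow> adjacent E B A"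
  unfolding adjacent_def by (metis insert_commute)

lemma adjacent_singletons [simp]: "adjacent E {a} {b} \<longleftrightarrow> {a, b} \<in> E"
  by (simp add: adjacent_def)

lemma adjacent_pair [simp]: "adjacent E {a, b} {c} \<longleftrightarrow> {a, c} \<in> E \<or> {b, c} \<in> E"
  by (simp add: adjacent_def)

lemma adjacent_Un_left [simp]: "adjacent E (A \<union> B) C \<longleftrightarrow> adjacent E A C \<or> adjacent E B C"
  unfolding adjacent_def by blast

lemma adjacent_Un_right [simp]: "adjacent E A (B \<union> C) \<longleftrightarrow> adjacent E A B \<or> adjacent E A C"
  unfolding adjacent_def by blast

lemma induced_connected_nonempty: "induced_connected E I \<Longrightarrow> I \<noteq> {}"
  by (simp add: induced_connected_def)

lemma induced_connected_singleton: "induced_connected E {a}"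
  by (simp add: induced_connected_def)

lemma induced_connected_Un:
  assumes "induced_connected E A" "induced_connected E B" "adjacent E A B"
  shows "induced_connected E (A \<union> B)"
proof -
  define R where "R I = {(a, b). a \<in> I \<and> b \<in> I \<and> {a, b} \<in> E}" for I
  obtain a b where ab: "a \<in> A" "b \<in> B" "{a, b} \<in> E"
    using assms(3) by (auto simp: adjacent_def)
  have mono: "(R A)\<^sup>* \<subseteq> (R (A \<union> B))\<^sup>*"
      "(R B)\<^sup>* \<subseteq> (R (A \<union> B))\<^sup>*"
    by (auto intro!: rtrancl_mono simp: R_def)
  have A: "(u, v) \<in> (R (A \<union> B))\<^sup>*" if "u \<in> A" "v \<in> A" for u v
    using assms(1) that mono(1) by (auto simp: induced_connected_def R_def)
  have B: "(u, v) \<in> (R (A \<union> B))\<^sup>*" if "u \<in> B" "v \<in> B" for u v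
    using assms(2) that mono(2) by (auto simp: induced_connected_def R_def)
  have ab': "(a, b) \<in> R (A \<union> B)" "(b, a) \<in> R (A \<union> B)"
    using ab by (auto simp: R_def insert_commute)
  have AB: "(u, v) \<in> (R (A \<union> B))\<^sup>*" if "u \<in> A" "v \<in> B" for u v
    using A[OF that(1) ab(1)] ab'(1) B[OF ab(2) that(2)]
    by (meson rtrancl.rtrancl_into_rtrancl rtrancl_trans)
  have BA: "(u, v) \<in> (R (A \<union> B))\<^sup>*" if "u \<in> B" "v \<in> A" for u v
    using B[OF that(1) ab(2)] ab'(2) A[OF ab(1) that(2)]
    by (meson rtrancl.rtrancl_into_rtrancl rtrancl_trans)
  have "\<forall>u\<in>A \<union> B. \<forall>v\<in>A \<union> B. (u, v) \<in> (R (A \<union> B))\<^sup>*"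
    using A B AB BA by blast
  then show ?thesis
    using ab(1) unfolding induced_connected_def R_def by blast
qed

lemma induced_connected_Un_adjacent:
  assumes "induced_connected E (A \<union> B)" "A \<inter> B = {}" "A \<noteq> {}" "B \<noteq> {}"
  shows "adjacent E A B"
proof (rule ccontr)
  assume not_adj: "\<not> adjacent E A B"
  let ?R = "{(a, b). a \<in> A \<union> B \<and> b \<in> A \<union> B \<and> {a, b} \<in> E}"
  obtain a b where ab: "a \<in> A" "b \<in> B" using assms by blast
  then have "(a, b) \<in> ?R\<^sup>*"
    using assms(1) by (simp add: induced_connected_def)
  then have "b \<in> A"
    by induction (use ab not_adj in \<open>auto simp: adjacent_def\<close>)
  then show False using ab assms(2) by blast
qed

lemma induced_connected_image_atLeastAtMost:
  assumes "a \<le> b" and "\<And>i. a \<le> i \<Longrightarrow> i < b \<Longrightarrow> {p i, p (Suc i)} \<in> E"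
  shows "induced_connected E (p ` {a..b})"
  using assms
proof (induction b rule: dec_induct)
  case base
  show ?case by (simp add: induced_connected_singleton)
next
  case (step b)
  have "adjacent E (p ` {a..b}) {p (Suc b)}"
    using step by (auto simp: adjacent_def intro!: bexI[of _ b])
  then have "induced_connected E (p ` {a..b} \<union> {p (Suc b)})"
    using step by (intro induced_connected_Un) (auto simp: induced_connected_singleton)
  moreover have "p ` {a..b} \<union> {p (Suc b)} = p ` {a..Suc b}"
    using step by (auto simp: atLeastAtMostSuc_conv)
  ultimately show ?case by simp
qed

text \<open>A maximal connected proper subset misses exactly one vertex.\<close>

lemma induced_connected_remove_vertex:
  assumes "finite W" "induced_connected E W" "card W \<ge> 2"
  obtains x where "x \<in> W" "induced_connected E (W - {x})"
proof -
  let ?P = "\<lambda>A. A \<subset> W \<and> induced_connected E A"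
  obtain w where w: "w \<in> W" using assms(3) by fastforce
  have P: "?P {w}"
    using w assms(3) induced_connected_singleton by (cases "W = {w}") auto
  have "\<forall>A. ?P A \<longrightarrow> card A < card W"
    using assms(1) psubset_card_mono by blast
  then obtain A where A: "?P A" and max: "\<And>B. ?P B \<Longrightarrow> card B \<le> card A"
    using ex_has_greatest_nat[of ?P, OF P, of card "card W"] by (metis less_imp_le)
  have "adjacent E A (W - A)"
    using A assms(2) induced_connected_nonempty[of E A]
    by (intro induced_connected_Un_adjacent) (auto simp: Un_absorb1 psubset_imp_subset)
  then obtain x where x: "x \<in> W - A" "adjacent E A {x}"
    by (auto simp: adjacent_def)
  have "induced_connected E (A \<union> {x})"
    using A x by (intro induced_connected_Un) (auto simp: induced_connected_singleton)
  moreover have "card (A \<union> {x}) > card A"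
    using A x assms(1) finite_subset[of A W] by auto
  ultimately have "A \<union> {x} = W"
    using max[of "A \<union> {x}"] A x by auto
  then have "W - {x} = A" using x by blast
  then show thesis using that A x by auto
qed

section \<open>Labelled paths and paths with a triangle\<close>

text \<open>The labelling runs from the model graph into \<open>E\<close>, onto an arbitrary vertex
  set \<open>W\<close>. Induced subgraphs can thus be extended vertex by vertex without renumbering
  the ambient graph.\<close>

definition parametrizes ::
  "nat set set \<Rightarrow> nat set \<Rightarrow> (nat \<Rightarrow> nat) \<Rightarrow> nat \<Rightarrow> nat set set \<Rightarrow> bool" where
  "parametrizes E W p m F \<longleftrightarrow> bij_betw p {1..m} W \<and>
     (\<forall>i\<in>{1..m}. \<forall>j\<in>{1..m}. {p i, p j} \<in> E \<longleftrightarrow> {i, j} \<in> F)"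

lemma path_edges_iff:
  "{i, j} \<in> path_edges m \<longleftrightarrow> 1 \<le> i \<and> j = i + 1 \<and> j \<le> m \<or> 1 \<le> j \<and> i = j + 1 \<and> i \<le> m"
  by (auto simp: path_edges_def doubleton_eq_iff)

lemma delta_edges_iff:
  "{i, j} \<in> delta_edges k \<longleftrightarrow>
     1 \<le> i \<and> j = i + 1 \<and> j \<le> k \<or> 1 \<le> j \<and> i = j + 1 \<and> i \<le> k \<or>
     i = k + 1 \<and> (j = 1 \<or> j = 2) \<or> j = k + 1 \<and> (i = 1 \<or> i = 2)"
  by (auto simp: delta_edges_def doubleton_eq_iff)

lemma parametrizes_image: "parametrizes E W p m F \<Longrightarrow> p ` {1..m} = W"
  by (simp add: parametrizes_def bij_betw_def)

lemma parametrizes_edge: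
  "parametrizes E W p m F \<Longrightarrow> i \<in> {1..m} \<Longrightarrow> j \<in> {1..m} \<Longrightarrow> {p i, p j} \<in> E \<longleftrightarrow> {i, j} \<in> F"
  by (simp add: parametrizes_def)

lemma parametrizes_eq:
  "parametrizes E W p m F \<Longrightarrow> i \<in> {1..m} \<Longrightarrow> j \<in> {1..m} \<Longrightarrow> p i = p j \<longleftrightarrow> i = j"
  unfolding parametrizes_def bij_betw_def using inj_on_eq_iff by metis

lemma parametrizes_mem: "parametrizes E W p m F \<Longrightarrow> i \<in> {1..m} \<Longrightarrow> p i \<in> W"
  using parametrizes_image by blast

lemma parametrizes_compose:
  assumes "parametrizes E W p m F" "bij_betw q {1..m} {1..m}"
    and "\<And>i j. i \<in> {1..m} \<Longrightarrow> j \<in> {1..m} \<Longrightarrow> {q i, q j} \<in> F \<longleftrightarrow> {i, j} \<in> F'"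
  shows "parametrizes E W (p \<circ> q) m F'"
proof -
  have "bij_betw (p \<circ> q) {1..m} W"
    using assms(1,2) bij_betw_trans by (auto simp: parametrizes_def)
  moreover have "q i \<in> {1..m}" if "i \<in> {1..m}" for i
    using bij_betwE[OF assms(2)] that by blast
  ultimately show ?thesis
    using assms(1,3) by (simp add: parametrizes_def)
qed

lemma parametrizes_rev_path:
  assumes "parametrizes E W p m (path_edges m)"
  shows "parametrizes E W (\<lambda>i. p (m + 1 - i)) m (path_edges m)"
proof -
  have "bij_betw (\<lambda>i. m + 1 - i) {1..m} {1..m}"
    by (rule bij_betw_byWitness[where f' = "\<lambda>i. m + 1 - i"]) auto
  then have "parametrizes E W (p \<circ> (\<lambda>i. m + 1 - i)) m (path_edges m)"
    by (rule parametrizes_compose[OF assms]) (auto simp: path_edges_iff)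
  then show ?thesis by (simp add: o_def)
qed

lemma parametrizes_delta_path:
  assumes "parametrizes E W p (k + 1) (delta_edges k)"
  shows "parametrizes E (p ` {1..k}) p k (path_edges k)"
proof -
  have "inj_on p {1..k + 1}" using assms by (simp add: parametrizes_def bij_betw_def)
  then have "bij_betw p {1..k} (p ` {1..k})"
    by (intro inj_on_imp_bij_betw) (auto elim: inj_on_subset)
  then show ?thesis
    using parametrizes_edge[OF assms] by (auto simp: parametrizes_def path_edges_iff delta_edges_iff)
qed

lemma parametrizes_extend:
  assumes p: "parametrizes E W p m F" and v: "v \<notin> W" "{v} \<notin> E"
    and F': "\<And>i j. i \<in> {1..m} \<Longrightarrow> j \<in> {1..m} \<Longrightarrow> {i, j} \<in> F' \<longleftrightarrow> {i, j} \<in> F"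
      "{m + 1} \<notin> F'"
          "\<And>i. i \<in> {1..m} \<Longrightarrow> {m + 1, i} \<in> F' \<longleftrightarrow> {v, p i} \<in> E"
  shows "parametrizes E (insert v W) (p(m + 1 := v)) (m + 1) F'"
proof -
  have eq: "(p(m + 1 := v)) i = p i" if "i \<in> {1..m}" for i using that by auto
  have b: "bij_betw (p(m + 1 := v)) {1..m} W"
    using p bij_betw_cong[of "{1..m}" "p(m + 1 := v)" p W] eq unfolding parametrizes_def by blast
  have "bij_betw (p(m + 1 := v)) (insert (m + 1) {1..m}) (insert v W)"
    using b v(1) notIn_Un_bij_betw[OF _ _ b, of "m + 1"] by auto
  moreover have "insert (m + 1) {1..m} = {1..m + 1}" by auto
  ultimately have bij: "bij_betw (p(m + 1 := v)) {1..m + 1} (insert v W)" by simp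
  have "{(p(m + 1 := v)) i, (p(m + 1 := v)) j} \<in> E \<longleftrightarrow> {i, j} \<in> F'"
    if ij: "i \<in> {1..m + 1}" "j \<in> {1..m + 1}" for i j
  proof -
    consider "i \<in> {1..m}" "j \<in> {1..m}" | "i = m + 1" "j \<in> {1..m}" | "i \<in> {1..m}"
        "j = m + 1"
      | "i = m + 1" "j = m + 1" using ij by fastforce
    then show ?thesis
    proof cases
      case 1
      then show ?thesis using eq F'(1) parametrizes_edge[OF p] by simp
    next
      case 2
      then show ?thesis using eq F'(3) by simp
    next
      case 3
      then show ?thesis using eq F'(3) by (simp add: insert_commute)
    next
      case 4
      then show ?thesis using v F'(2) by simp
    qed
  qed
  then show ?thesis using bij unfolding parametrizes_def by blast
qed

lemma delta_edges_2_iff: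
  "i \<in> {1..3} \<Longrightarrow> j \<in> {1..3} \<Longrightarrow> {i, j} \<in> delta_edges 2 \<longleftrightarrow> i \<noteq> j"
  by (auto simp: delta_edges_iff)

lemma parametrizes_extend_path:
  assumes p: "parametrizes E W p m (path_edges m)" and v: "v \<notin> W" "{v} \<notin> E"
    and N: "{i \<in> {1..m}. {v, p i} \<in> E} = {m}"
  shows "parametrizes E (insert v W) (p(m + 1 := v)) (m + 1) (path_edges (m + 1))"
proof (rule parametrizes_extend[OF p v])
  show "{m + 1} \<notin> path_edges (m + 1)"
    using path_edges_iff[of "m + 1" "m + 1" "m + 1"] by simp
  show "{m + 1, i} \<in> path_edges (m + 1) \<longleftrightarrow> {v, p i} \<in> E" if "i \<in> {1..m}" for i
  proof -
    have "{v, p i} \<in> E \<longleftrightarrow> i \<in> {m}" unfolding N[symmetric] using that by simp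
    then show ?thesis using path_edges_iff[of "m + 1" i "m + 1"] that by auto
  qed
qed (auto simp: path_edges_iff)

lemma parametrizes_extend_path_delta:
  assumes p: "parametrizes E W p m (path_edges m)" and v: "v \<notin> W" "{v} \<notin> E" and m: "m \<ge> 2"
    and N: "{i \<in> {1..m}. {v, p i} \<in> E} = {1, 2}"
  shows "parametrizes E (insert v W) (p(m + 1 := v)) (m + 1) (delta_edges m)"
proof (rule parametrizes_extend[OF p v])
  show "{m + 1} \<notin> delta_edges m"
    using delta_edges_iff[of "m + 1" "m + 1" m] m by simp
  show "{m + 1, i} \<in> delta_edges m \<longleftrightarrow> {v, p i} \<in> E" if "i \<in> {1..m}" for i
  proof -
    have "{v, p i} \<in> E \<longleftrightarrow> i \<in> {1, 2}" unfolding N[symmetric] using that by simp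
    then show ?thesis using delta_edges_iff[of "m + 1" i m] that by auto
  qed
qed (auto simp: path_edges_iff delta_edges_iff)

lemma parametrizes_extend_delta:
  assumes p: "parametrizes E W p (k + 1) (delta_edges k)" and v: "v \<notin> W" "{v} \<notin> E" and k: "k \<ge> 2"
    and N: "{i \<in> {1..k + 1}. {v, p i} \<in> E} = {k}"
  shows "\<exists>q. parametrizes E (insert v W) q (k + 1 + 1) (delta_edges (k + 1))"
proof -
  let ?F = "insert {k, k + 2} (delta_edges k)"
  \<comment> \<open>The model keeps the tip of the triangle at the last label, so the new end of the
    path takes k + 1 and the tip moves to k + 2.\<close>
  let ?q = "\<lambda>i. if i = k + 1 then k + 2 else if i = k + 2 then k + 1 else i"
  have "parametrizes E (insert v W) (p(k + 1 + 1 := v)) (k + 1 + 1) ?F"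
  proof (rule parametrizes_extend[OF p v])
    show "{k + 1 + 1} \<notin> ?F"
      using delta_edges_iff[of "k + 2" "k + 2" k] k by simp
    show "{k + 1 + 1, i} \<in> ?F \<longleftrightarrow> {v, p i} \<in> E" if "i \<in> {1..k + 1}" for i
    proof -
      have "{v, p i} \<in> E \<longleftrightarrow> i \<in> {k}" unfolding N[symmetric] using that by simp
      then show ?thesis
        using delta_edges_iff[of "k + 2" i k] that k by (auto simp: doubleton_eq_iff)
    qed
  qed (auto simp: doubleton_eq_iff)
  moreover have "bij_betw ?q {1..k + 1 + 1} {1..k + 1 + 1}"
    by (rule bij_betw_byWitness[where f' = ?q]) auto
  moreover have "{?q i, ?q j} \<in> ?F \<longleftrightarrow> {i, j} \<in> delta_edges (k + 1)"
    if "i \<in> {1..k + 1 + 1}" "j \<in> {1..k + 1 + 1}" for i j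
    unfolding insert_iff[of _ "{k, k + 2}"] delta_edges_iff doubleton_eq_iff using that k by auto
  ultimately show ?thesis
    using parametrizes_compose by blast
qed

section \<open>Obstructions from flats of rank two\<close>

text \<open>Not all equal, because some block must meet the flat in one hyperplane; not all
  distinct, because the three forms could then be chosen from different blocks although they are
  dependent.\<close>

definition two_colored :: "'a \<Rightarrow> 'a \<Rightarrow> 'a \<Rightarrow> bool" where
  "two_colored a b c \<longleftrightarrow> a = b \<and> a \<noteq> c \<or> a = c \<and> a \<noteq> b \<or> b = c \<and> a \<noteq> b"

text \<open>The conditions imposed on a nice partition by the flats of rank two, read as conditions on
  the colouring that sends a connected set to the block of its hyperplane.\<close>

locale rank2_coloring =
  fixes E :: "nat set set" and V :: "nat set" and col :: "nat set \<Rightarrow> nat"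
  assumes loopless: "{v} \<notin> E"
    and crossing:
      "\<lbrakk>induced_connected E I; induced_connected E J; I \<subseteq> V; J \<subseteq> V;
        I \<inter> J \<noteq> {}; \<not> I \<subseteq> J; \<not> J \<subseteq> I\<rbrakk> \<Longrightarrow> col I \<noteq> col J"
    and separated:
      "\<lbrakk>induced_connected E I; induced_connected E J; I \<subseteq> V; J \<subseteq> V;
        I \<inter> J = {}; \<not> induced_connected E (I \<union> J)\<rbrakk> \<Longrightarrow> col I \<noteq> col J"
    and disconnected_difference:
      "\<lbrakk>induced_connected E I; induced_connected E J; J \<subseteq> V;
        I \<subset> J; \<not> induced_connected E (J - I)\<rbrakk> \<Longrightarrow> col I \<noteq> col J"
    and disjoint_union:
      "\<lbrakk>induced_connected E I; induced_connected E J; induced_connected E K; K \<subseteq> V;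
        I \<inter> J = {}; K = I \<union> J\<rbrakk> \<Longrightarrow> two_colored (col I) (col J) (col K)"
begin

text \<open>These serve as branch sets of an induced minor: the obstructions are proved for disjoint
  parts in place of vertices, so no contracted graph has to be constructed.\<close>

definition part :: "nat set \<Rightarrow> bool" where
  "part I \<longleftrightarrow> I \<subseteq> V \<and> induced_connected E I"

lemma part_Un: "part A \<Longrightarrow> part B \<Longrightarrow> adjacent E A B \<Longrightarrow> part (A \<union> B)"
  by (simp add: part_def induced_connected_Un)

lemma part_singleton: "v \<in> V \<Longrightarrow> part {v}"
  by (simp add: part_def induced_connected_singleton)

lemma part_pair: "a \<in> V \<Longrightarrow> b \<in> V \<Longrightarrow> {a, b} \<in> E \<Longrightarrow> part {a, b}"
  using part_Un[OF part_singleton part_singleton] by (simp add: insert_commute)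

lemma not_part_Un:
  "part A \<Longrightarrow> part B \<Longrightarrow> A \<inter> B = {} \<Longrightarrow> \<not> adjacent E A B \<Longrightarrow> \<not> induced_connected E (A \<union> B)"
  using induced_connected_Un_adjacent[of E A B] induced_connected_nonempty[of E] by (auto simp: part_def)

lemma part_crossing:
  "part I \<Longrightarrow> part J \<Longrightarrow> I \<inter> J \<noteq> {} \<Longrightarrow> \<not> I \<subseteq> J \<Longrightarrow> \<not> J \<subseteq> I \<Longrightarrow> col I \<noteq> col J"
  by (rule crossing) (auto simp: part_def)

lemma part_disconnected_difference:
  assumes "part I" "part J" "A \<noteq> {}" "B \<noteq> {}" "J - I = A \<union> B"
      "I \<subseteq> J" "A \<inter> B = {}"
    "\<not> adjacent E A B"
  shows "col I \<noteq> col J"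
proof (rule disconnected_difference)
  show "\<not> induced_connected E (J - I)" using induced_connected_Un_adjacent assms by metis
  show "I \<subset> J" using assms by blast
qed (use assms part_def in auto)

lemma part_disjoint_union:
  "part I \<Longrightarrow> part J \<Longrightarrow> part K \<Longrightarrow> I \<inter> J = {} \<Longrightarrow> K = I \<union> J \<Longrightarrow> two_colored (col I) (col J) (col K)"
  by (rule disjoint_union) (auto simp: part_def)

lemma no_claw:
  assumes parts: "part a" "part b" "part c" "part d"
    and disj: "a \<inter> b = {}" "a \<inter> c = {}" "a \<inter> d = {}" "b \<inter> c = {}"
      "b \<inter> d = {}" "c \<inter> d = {}"
    and adj: "adjacent E a b" "adjacent E a c" "adjacent E a d"
    and nonadj: "\<not> adjacent E b c" "\<not> adjacent E b d" "\<not> adjacent E c d"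
  shows False
proof -
  have nonempty: "a \<noteq> {}" "b \<noteq> {}" "c \<noteq> {}" "d \<noteq> {}"
    using parts induced_connected_nonempty by (auto simp: part_def)
  then obtain xa xb xc xd where el: "xa \<in> a" "xb \<in> b" "xc \<in> c" "xd \<in> d"
    by auto
  have notin: "xa \<notin> b" "xa \<notin> c" "xa \<notin> d" "xb \<notin> a" "xb \<notin> c"
      "xb \<notin> d" "xc \<notin> a" "xc \<notin> b" "xc \<notin> d" "xd \<notin> a"
      "xd \<notin> b" "xd \<notin> c"
    using disj el by auto
  have adj': "adjacent E b a" "adjacent E c a" "adjacent E d a"
    using adj adjacent_commute by blast+
  have pairs: "part (a \<union> b)" "part (a \<union> c)" "part (a \<union> d)"
    using parts adj adj' by (simp_all add: part_Un)
  have triples: "part (a \<union> b \<union> c)" "part (a \<union> b \<union> d)"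
      "part (a \<union> c \<union> d)"
    using parts adj adj' pairs by (simp add: part_Un; fail | simp add: part_Un Un_assoc)+
  have quadruples: "part (a \<union> b \<union> c \<union> d)"
    using parts adj adj' triples by (simp_all add: part_Un)
  note parts = parts pairs triples quadruples
  have crossing: "col (a \<union> b) \<noteq> col (a \<union> c)"
      "col (a \<union> b) \<noteq> col (a \<union> d)"
      "col (a \<union> b) \<noteq> col (a \<union> c \<union> d)"
      "col (a \<union> c) \<noteq> col (a \<union> d)"
      "col (a \<union> c) \<noteq> col (a \<union> b \<union> d)"
      "col (a \<union> b \<union> c) \<noteq> col (a \<union> d)"
      "col (a \<union> b \<union> c) \<noteq> col (a \<union> b \<union> d)"
      "col (a \<union> b \<union> c) \<noteq> col (a \<union> c \<union> d)"
      "col (a \<union> b \<union> d) \<noteq> col (a \<union> c \<union> d)"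
    by (rule part_crossing; (rule parts)?; use el notin in blast)+
  have diff0: "col a \<noteq> col (a \<union> b \<union> c)"
    by (rule part_disconnected_difference[OF _ _ _ _ _ _ _ nonadj(1)]; (rule parts nonempty)?; use disj in auto)
  have diff1: "col a \<noteq> col (a \<union> b \<union> d)"
    by (rule part_disconnected_difference[OF _ _ _ _ _ _ _ nonadj(2)]; (rule parts nonempty)?; use disj in auto)
  have diff2: "col a \<noteq> col (a \<union> c \<union> d)"
    by (rule part_disconnected_difference[OF _ _ _ _ _ _ _ nonadj(3)]; (rule parts nonempty)?; use disj in auto)
  have diff3: "col a \<noteq> col (a \<union> b \<union> c \<union> d)"
    by (rule part_disconnected_difference[of _ _ b "c \<union> d"]; (rule parts)?; use disj nonadj nonempty in auto)
  have diff4: "col (a \<union> b) \<noteq> col (a \<union> b \<union> c \<union> d)"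
    by (rule part_disconnected_difference[OF _ _ _ _ _ _ _ nonadj(3)]; (rule parts nonempty)?; use disj in auto)
  have diff5: "col (a \<union> c) \<noteq> col (a \<union> b \<union> c \<union> d)"
    by (rule part_disconnected_difference[OF _ _ _ _ _ _ _ nonadj(2)]; (rule parts nonempty)?; use disj in auto)
  have diff6: "col (a \<union> d) \<noteq> col (a \<union> b \<union> c \<union> d)"
    by (rule part_disconnected_difference[OF _ _ _ _ _ _ _ nonadj(1)]; (rule parts nonempty)?; use disj in auto)
  have unions: "two_colored (col a) (col b) (col (a \<union> b))"
    "two_colored (col b) (col (a \<union> c \<union> d)) (col (a \<union> b \<union> c \<union> d))"
    "two_colored (col (a \<union> b)) (col c) (col (a \<union> b \<union> c))"
    "two_colored (col (a \<union> b)) (col d) (col (a \<union> b \<union> d))"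
    "two_colored (col c) (col (a \<union> d)) (col (a \<union> c \<union> d))"
    "two_colored (col (a \<union> c)) (col d) (col (a \<union> c \<union> d))"
    by (rule part_disjoint_union; (rule parts)?; use disj in auto)+
  \<comment> \<open>Write ab for the colour of \<open>a \<union> b\<close>, and so on. The colour c
    cannot lie both in {ab, abc} and in {ad, acd}, so ab = abc or ad = acd; likewise d gives ab =
    abd or ac = acd. Crossing leaves ab = abc with ac = acd, or ab = abd with ad = acd. Either way b
    lies in {a, ab} and in {acd, abcd}, which are disjoint.\<close>
  show False
    using crossing unions diff0 diff1 diff2 diff3 diff4 diff5 diff6 unfolding two_colored_def by (smt (verit))
qed

text \<open>The diagonals are left open so that an arc of a longer cycle can be contracted even if
  its inner vertices have neighbours in other branch sets.\<close>

lemma no_four_cycle: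
  assumes parts: "part a" "part b" "part c" "part d"
    and disj: "a \<inter> b = {}" "a \<inter> c = {}" "a \<inter> d = {}" "b \<inter> c = {}"
      "b \<inter> d = {}" "c \<inter> d = {}"
    and adj: "adjacent E a b" "adjacent E b c" "adjacent E c d" "adjacent E d a"
  shows False
proof -
  have nonempty: "a \<noteq> {}" "b \<noteq> {}" "c \<noteq> {}" "d \<noteq> {}"
    using parts induced_connected_nonempty by (auto simp: part_def)
  then obtain xa xb xc xd where el: "xa \<in> a" "xb \<in> b" "xc \<in> c" "xd \<in> d"
    by auto
  have notin: "xa \<notin> b" "xa \<notin> c" "xa \<notin> d" "xb \<notin> a" "xb \<notin> c"
      "xb \<notin> d" "xc \<notin> a" "xc \<notin> b" "xc \<notin> d" "xd \<notin> a"
      "xd \<notin> b" "xd \<notin> c"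
    using disj el by auto
  have adj': "adjacent E b a" "adjacent E c b" "adjacent E d c" "adjacent E a d"
    using adj adjacent_commute by blast+
  have pairs: "part (a \<union> b)" "part (a \<union> d)" "part (b \<union> c)"
      "part (c \<union> d)"
    using parts adj adj' by (simp_all add: part_Un)
  have triples: "part (a \<union> b \<union> c)" "part (a \<union> b \<union> d)"
      "part (a \<union> c \<union> d)" "part (b \<union> c \<union> d)"
    using parts adj adj' pairs by (simp add: part_Un; fail | simp add: part_Un Un_assoc)+
  have quadruples: "part (a \<union> b \<union> c \<union> d)"
    using parts adj adj' triples by (simp_all add: part_Un)
  note parts = parts pairs triples quadruples
  have crossing: "col (a \<union> b) \<noteq> col (b \<union> c)"
      "col (a \<union> b) \<noteq> col (a \<union> d)"
      "col (a \<union> b) \<noteq> col (a \<union> c \<union> d)"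
      "col (a \<union> b) \<noteq> col (b \<union> c \<union> d)"
      "col (b \<union> c) \<noteq> col (a \<union> b \<union> d)"
      "col (b \<union> c) \<noteq> col (c \<union> d)"
      "col (b \<union> c) \<noteq> col (a \<union> c \<union> d)"
      "col (a \<union> b \<union> c) \<noteq> col (a \<union> d)"
      "col (a \<union> b \<union> c) \<noteq> col (a \<union> b \<union> d)"
      "col (a \<union> b \<union> c) \<noteq> col (c \<union> d)"
      "col (a \<union> b \<union> c) \<noteq> col (a \<union> c \<union> d)"
      "col (a \<union> b \<union> c) \<noteq> col (b \<union> c \<union> d)"
      "col (a \<union> d) \<noteq> col (c \<union> d)"
      "col (a \<union> d) \<noteq> col (b \<union> c \<union> d)"
      "col (a \<union> b \<union> d) \<noteq> col (c \<union> d)"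
      "col (a \<union> b \<union> d) \<noteq> col (b \<union> c \<union> d)"
      "col (a \<union> c \<union> d) \<noteq> col (b \<union> c \<union> d)"
    by (rule part_crossing; (rule parts)?; use el notin in blast)+
  have unions: "two_colored (col a) (col (b \<union> c)) (col (a \<union> b \<union> c))"
    "two_colored (col a) (col (c \<union> d)) (col (a \<union> c \<union> d))"
    "two_colored (col (a \<union> b)) (col d) (col (a \<union> b \<union> d))"
    "two_colored (col (a \<union> b)) (col (c \<union> d)) (col (a \<union> b \<union> c \<union> d))"
    "two_colored (col (b \<union> c)) (col d) (col (b \<union> c \<union> d))"
    "two_colored (col (b \<union> c)) (col (a \<union> d)) (col (a \<union> b \<union> c \<union> d))"
    "two_colored (col (a \<union> b \<union> c)) (col d) (col (a \<union> b \<union> c \<union> d))"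
    by (rule part_disjoint_union; (rule parts)?; use disj in auto)+
  \<comment> \<open>With ab for the colour of \<open>a \<union> b\<close>, and so on: abcd cannot
    lie both in {ab, cd} and in {bc, ad}, so ab = cd or bc = ad. The unions with a give bc = abc or
    cd = acd, those with d give ab = abd or bc = bcd. If ab = cd, only bc = abc = bcd remains,
    although these triples cross. If bc = ad, then cd = acd and ab = abd remain, and no two of abc,
    d, abcd can agree.\<close>
  show False
    using crossing unions unfolding two_colored_def by (smt (verit))
qed

text \<open>Only two non-adjacencies matter; the butterfly is the case where \<open>b\<close>, \<open>c\<close> and \<open>d\<close>, \<open>e\<close> are adjacent.\<close>

lemma no_four_star:
  assumes parts: "part a" "part b" "part c" "part d" "part e"
    and disj: "a \<inter> b = {}" "a \<inter> c = {}" "a \<inter> d = {}" "a \<inter> e = {}"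
      "b \<inter> c = {}" "b \<inter> d = {}" "b \<inter> e = {}" "c \<inter> d = {}"
      "c \<inter> e = {}" "d \<inter> e = {}"
    and adj: "adjacent E a b" "adjacent E a c" "adjacent E a d" "adjacent E a e"
    and nonadj: "\<not> adjacent E c d" "\<not> adjacent E c e"
  shows False
proof -
  have nonempty: "a \<noteq> {}" "b \<noteq> {}" "c \<noteq> {}" "d \<noteq> {}" "e \<noteq> {}"
    using parts induced_connected_nonempty by (auto simp: part_def)
  then obtain xa xb xc xd xe where el: "xa \<in> a" "xb \<in> b" "xc \<in> c" "xd \<in> d"
      "xe \<in> e"
    by auto
  have notin: "xa \<notin> b" "xa \<notin> c" "xa \<notin> d" "xa \<notin> e" "xb \<notin> a"
      "xb \<notin> c" "xb \<notin> d" "xb \<notin> e" "xc \<notin> a" "xc \<notin> b"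
      "xc \<notin> d" "xc \<notin> e" "xd \<notin> a" "xd \<notin> b" "xd \<notin> c"
      "xd \<notin> e" "xe \<notin> a" "xe \<notin> b" "xe \<notin> c" "xe \<notin> d"
    using disj el by auto
  have adj': "adjacent E b a" "adjacent E c a" "adjacent E d a" "adjacent E e a"
    using adj adjacent_commute by blast+
  have pairs: "part (a \<union> b)" "part (a \<union> d)" "part (a \<union> e)"
      "part (a \<union> c)"
    using parts adj adj' by (simp_all add: part_Un)
  have triples: "part (a \<union> b \<union> c)" "part (a \<union> b \<union> d)"
      "part (a \<union> b \<union> e)" "part (a \<union> d \<union> e)"
      "part (a \<union> c \<union> d)"
    using parts adj adj' pairs by (simp add: part_Un; fail | simp add: part_Un Un_assoc)+
  have quadruples: "part (a \<union> c \<union> d \<union> e)"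
    using parts adj adj' triples by (simp_all add: part_Un)
  note parts = parts pairs triples quadruples
  have crossing: "col (a \<union> b) \<noteq> col (a \<union> d)"
      "col (a \<union> b) \<noteq> col (a \<union> e)"
      "col (a \<union> b) \<noteq> col (a \<union> c \<union> d \<union> e)"
      "col (a \<union> b \<union> c) \<noteq> col (a \<union> b \<union> d)"
      "col (a \<union> b \<union> c) \<noteq> col (a \<union> b \<union> e)"
      "col (a \<union> b \<union> c) \<noteq> col (a \<union> d \<union> e)"
      "col (a \<union> b \<union> c) \<noteq> col (a \<union> c \<union> d \<union> e)"
      "col (a \<union> d) \<noteq> col (a \<union> e)"
      "col (a \<union> d) \<noteq> col (a \<union> b \<union> e)"
      "col (a \<union> b \<union> d) \<noteq> col (a \<union> e)"
      "col (a \<union> b \<union> d) \<noteq> col (a \<union> b \<union> e)"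
      "col (a \<union> b \<union> d) \<noteq> col (a \<union> d \<union> e)"
      "col (a \<union> b \<union> e) \<noteq> col (a \<union> d \<union> e)"
    by (rule part_crossing; (rule parts)?; use el notin in blast)+
  have separated: "col c \<noteq> col e"
    using parts disj nonadj not_part_Un[of c e] by (intro separated) (auto simp: part_def)
  have diff0: "col (a \<union> d) \<noteq> col (a \<union> c \<union> d \<union> e)"
    by (rule part_disconnected_difference[OF _ _ _ _ _ _ _ nonadj(2)]; (rule parts nonempty)?; use disj in auto)
  have diff1: "col (a \<union> e) \<noteq> col (a \<union> c \<union> d \<union> e)"
    by (rule part_disconnected_difference[OF _ _ _ _ _ _ _ nonadj(1)]; (rule parts nonempty)?; use disj in auto)
  have unions: "two_colored (col (a \<union> b)) (col c) (col (a \<union> b \<union> c))"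
    "two_colored (col (a \<union> b)) (col d) (col (a \<union> b \<union> d))"
    "two_colored (col (a \<union> b)) (col e) (col (a \<union> b \<union> e))"
    "two_colored (col c) (col (a \<union> d \<union> e)) (col (a \<union> c \<union> d \<union> e))"
    "two_colored (col d) (col (a \<union> e)) (col (a \<union> d \<union> e))"
    "two_colored (col (a \<union> d)) (col e) (col (a \<union> d \<union> e))"
    by (rule part_disjoint_union; (rule parts)?; use disj in auto)+
  \<comment> \<open>With ab for the colour of \<open>a \<union> b\<close>, and so on: if ab = ade,
    then c, d and e all take this colour, against \<open>separated\<close>. Otherwise c demands ab =
    abc or ade = acde, d demands ab = abd or ade = ae, and e demands ab = abe or ade = ad. Since
    abc, abd, abe are distinct and so are acde, ae, ad, each of ab and ade meets at most one of the
    three demands.\<close>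
  show False
    using crossing unions separated diff0 diff1 unfolding two_colored_def by (smt (verit))
qed

section \<open>Attaching one vertex to a path or to a path with a triangle\<close>

text \<open>Only the extreme neighbours matter. Far apart, they close a cycle that contracts to a
  4-cycle; equal or consecutive but away from both ends, they leave path vertices on either side and
  give a claw.\<close>

lemma path_attachment:
  assumes p: "parametrizes E W p m (path_edges m)" and W: "W \<subseteq> V" and v: "v \<in> V"
      "v \<notin> W"
    and N: "N = {i \<in> {1..m}. {v, p i} \<in> E}" "N \<noteq> {}"
  shows "N = {1} \<or> N = {m} \<or> N = {1, 2} \<or> N = {m - 1, m}"
proof -
  have fin: "finite N" and N_sub: "N \<subseteq> {1..m}" using N by auto
  note [simp] = parametrizes_edge[OF p] parametrizes_eq[OF p] path_edges_iff
  have pV [simp]: "p i \<in> V" if "i \<in> {1..m}" for i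
    using parametrizes_mem[OF p that] W by blast
  have pv [simp]: "p i \<noteq> v" "v \<noteq> p i" if "i \<in> {1..m}" for i
    using parametrizes_mem[OF p that] v by auto
  have vp [simp]: "{v, p i} \<in> E \<longleftrightarrow> i \<in> N" "{p i, v} \<in> E \<longleftrightarrow> i \<in> N" if "i \<in> {1..m}" for i
    using that N by (auto simp: insert_commute)
  define i j where "i = Min N" and "j = Max N"
  have ij: "i \<in> N" "j \<in> N" "i \<le> j" and bounds: "\<And>l. l \<in> N \<Longrightarrow> i \<le> l \<and> l \<le> j"
    using fin N(2) by (auto simp: i_def j_def)
  then have rng: "1 \<le> i" "j \<le> m" using N_sub by auto
  consider "i + 2 \<le> j" | "j = i" | "j = i + 1" using ij by linarith
  then show ?thesis
  proof cases
    case 1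
    have ends: "i \<in> {1..m}" "i + 1 \<in> {1..m}" "j - 1 \<in> {1..m}" "j \<in> {1..m}"
      unfolding atLeastAtMost_iff using 1 rng by arith+
    \<comment> \<open>The segment strictly between the extreme neighbours becomes the vertex
      opposite \<open>v\<close> in a 4-cycle.\<close>
    have "induced_connected E (p ` {i + 1..j - 1})"
      using 1 rng by (intro induced_connected_image_atLeastAtMost) auto
    then have "part (p ` {i + 1..j - 1})"
      using rng by (auto simp: part_def)
    moreover have "part {v}" "part {p i}" "part {p j}"
      using v rng ij by (auto intro: part_singleton)
    moreover have "{p i, p (i + 1)} \<in> E" "{p (j - 1), p j} \<in> E"
      using ends parametrizes_edge[OF p ends(1,2)] parametrizes_edge[OF p ends(3,4)] by simp_all
    then have "adjacent E {p i} (p ` {i + 1..j - 1})" "adjacent E (p ` {i + 1..j - 1}) {p j}"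
      using 1 unfolding adjacent_def by force+
    moreover have "v \<notin> p ` {i + 1..j - 1}" "p i \<notin> p ` {i + 1..j - 1}"
        "p j \<notin> p ` {i + 1..j - 1}"
      using 1 rng by auto
    ultimately have False
      using no_four_cycle[of "{v}" "{p i}" "p ` {i + 1..j - 1}" "{p j}"] 1 rng ij by auto
    then show ?thesis ..
  next
    case 2
    then have N_eq: "N = {i}" using ij bounds by force
    have "i = 1 \<or> i = m"
    proof (rule ccontr)
      assume "\<not> (i = 1 \<or> i = m)"
      then obtain l where i: "i = l + 1" "1 \<le> l" "l + 1 < m"
        using rng 2 that[of "i - 1"] by force
      have "part {v}" "part {p i}" "part {p l}" "part {p (i + 1)}"
        using v i by (auto intro: part_singleton)
      then show False
        using no_claw[of "{p i}" "{v}" "{p l}" "{p (i + 1)}"] i N_eq by auto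
    qed
    then show ?thesis using N_eq by auto
  next
    case 3
    then have N_eq: "N = {i, i + 1}" using ij bounds by force
    have "i = 1 \<or> i + 1 = m"
    proof (rule ccontr)
      assume "\<not> (i = 1 \<or> i + 1 = m)"
      then obtain l where i: "i = l + 1" "1 \<le> l" "l + 2 < m"
        using rng 3 that[of "i - 1"] by force
      have parts: "part {v}" "part {p l}" "part {p (i + 2)}"
        using v i by (auto intro: part_singleton)
      \<comment> \<open>The edge between the two neighbours is contracted to the centre of a
        claw.\<close>
      have "part {p i, p (i + 1)}" using i by (intro part_pair) auto
      then show False
        using no_claw[of "{p i, p (i + 1)}" "{v}" "{p l}" "{p (i + 2)}"] parts i N_eq by auto
    qed
    then show ?thesis using N_eq by auto
  qed
qed

text \<open>Vertices 1 and k + 1 are interchangeable, so excluding one as a neighbour excludes both,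
  and the path 1..k decides the rest. For k = 2 vertex 2 is interchangeable with them as well; that
  case is left to \<open>path_or_delta\<close>.\<close>

lemma delta_attachment:
  assumes p: "parametrizes E W p (k + 1) (delta_edges k)" and k: "k \<ge> 3"
    and W: "W \<subseteq> V" and v: "v \<in> V" "v \<notin> W"
    and N: "N = {i \<in> {1..k + 1}. {v, p i} \<in> E}" "N \<noteq> {}"
  shows "N = {k}"
proof -
  \<comment> \<open>Stated for every labelling, so that it applies again after the automorphism
    exchanging 1 and k + 1.\<close>
  have swap: "1 \<notin> N" if p: "parametrizes E W p (k + 1) (delta_edges k)"
    and N: "N = {i \<in> {1..k + 1}. {v, p i} \<in> E}" for p N
  proof
    assume 1: "1 \<in> N"
    have N_path: "N \<inter> {1..k} = {i \<in> {1..k}. {v, p i} \<in> E}" using N by auto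
    note [simp] = parametrizes_edge[OF p] parametrizes_eq[OF p] delta_edges_iff
    have pV [simp]: "p i \<in> V" if "i \<in> {1..k + 1}" for i
      using parametrizes_mem[OF p that] W by blast
    have pv [simp]: "p i \<noteq> v" "v \<noteq> p i" if "i \<in> {1..k + 1}" for i
      using parametrizes_mem[OF p that] v by auto
    have vp [simp]: "{v, p i} \<in> E \<longleftrightarrow> i \<in> N" "{p i, v} \<in> E \<longleftrightarrow> i \<in> N" if "i \<in> {1..k + 1}" for i
      using that N by (auto simp: insert_commute)
    have path: "parametrizes E (p ` {1..k}) p k (path_edges k)"
      by (rule parametrizes_delta_path[OF p])
    have sub: "p ` {1..k} \<subseteq> V" "v \<notin> p ` {1..k}" by auto
    have one: "1 \<in> N \<inter> {1..k}" "1 \<noteq> k" "1 \<noteq> k - 1" using 1 k by auto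
    then have "N \<inter> {1..k} \<noteq> {}" by blast
    then have N_path: "N \<inter> {1..k} = {1} \<or> N \<inter> {1..k} = {1, 2}"
      using path_attachment[OF path sub(1) v(1) sub(2) N_path] one by blast
    have parts: "part {v}" "part {p 1}" "part {p 2}" "part {p 3}" "part {p (k + 1)}"
      using v k by (auto intro!: part_singleton)
    have "3 \<notin> N \<inter> {1..k}"
      using N_path by (elim disjE; simp only: insert_iff empty_iff; simp)
    then have three: "3 \<notin> N" using k by simp
    \<comment> \<open>A second neighbour of \<open>v\<close> in the triangle closes a 4-cycle;
      without one, the contracted edge from 1 to 2 is the centre of a claw with leaves
      \<open>v\<close>, k + 1 and 3.\<close>
    consider "2 \<in> N" | "2 \<notin> N" "k + 1 \<in> N" | "2 \<notin> N" "k + 1 \<notin> N" by blast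
    then show False
    proof cases
      case 1
      show False
        by (rule no_four_cycle[OF parts(1,2,5,3)]) (use k 1 \<open>1 \<in> N\<close> in auto)
    next
      case 2
      show False
        by (rule no_four_cycle[OF parts(1,2,3,5)]) (use k 2 \<open>1 \<in> N\<close> in auto)
    next
      case 3
      have "part {p 1, p 2}" using k by (intro part_pair) auto
      then show False
        using no_claw[of "{p 1, p 2}" "{v}" "{p (k + 1)}" "{p 3}"] parts k 3 \<open>1 \<in> N\<close> three by auto
    qed
  qed
  have 1: "1 \<notin> N" by (rule swap[OF p N(1)])
  let ?q = "\<lambda>i. if i = 1 then k + 1 else if i = k + 1 then 1 else i"
  have "bij_betw ?q {1..k + 1} {1..k + 1}"
    by (rule bij_betw_byWitness[where f' = ?q]) (use k in auto)
  then have "parametrizes E W (p \<circ> ?q) (k + 1) (delta_edges k)"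
    by (rule parametrizes_compose[OF p]) (use k in \<open>auto simp: delta_edges_iff\<close>)
  from swap[OF this refl] have t: "k + 1 \<notin> N" using N by auto
  have N_path: "N = {i \<in> {1..k}. {v, p i} \<in> E}" using N t by (auto simp: le_Suc_eq)
  note [simp] = parametrizes_edge[OF p] parametrizes_eq[OF p] delta_edges_iff
  have pV [simp]: "p i \<in> V" if "i \<in> {1..k + 1}" for i
    using parametrizes_mem[OF p that] W by blast
  have pv [simp]: "p i \<noteq> v" "v \<noteq> p i" if "i \<in> {1..k + 1}" for i
    using parametrizes_mem[OF p that] v by auto
  have vp [simp]: "{v, p i} \<in> E \<longleftrightarrow> i \<in> N" "{p i, v} \<in> E \<longleftrightarrow> i \<in> N" if "i \<in> {1..k + 1}" for i
    using that N by (auto simp: insert_commute)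
  have path: "parametrizes E (p ` {1..k}) p k (path_edges k)"
    by (rule parametrizes_delta_path[OF p])
  have sub: "p ` {1..k} \<subseteq> V" "v \<notin> p ` {1..k}" by auto
  have "N = {k} \<or> N = {k - 1, k}"
    using path_attachment[OF path sub(1) v(1) sub(2) N_path N(2)] 1 by blast
  moreover have False if "N = {k - 1, k}"
  proof -
    from k obtain l where l: "k = l + 1" "2 \<le> l" by (intro that[of "k - 1"]) auto
    then have N_eq: "N = {l, k}" using \<open>N = {k - 1, k}\<close> by simp
    \<comment> \<open>Contracting the segment from 2 to l gives the centre of a butterfly: one wing
      is the old triangle, the other is spanned by \<open>p k\<close> and \<open>v\<close>.\<close>
    have "induced_connected E (p ` {2..l})"
      using l by (intro induced_connected_image_atLeastAtMost) auto
    then have "part (p ` {2..l})"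
      using l by (auto simp: part_def)
    moreover have "part {p (k + 1)}" "part {p 1}" "part {p k}" "part {v}"
      using v l by (auto intro!: part_singleton)
    moreover have "{p 2, p (k + 1)} \<in> E" "{p 2, p 1} \<in> E" "{p l, p k} \<in> E"
        "{p l, v} \<in> E"
      using l N_eq by auto
    then have "adjacent E (p ` {2..l}) {p (k + 1)}" "adjacent E (p ` {2..l}) {p 1}"
      "adjacent E (p ` {2..l}) {p k}" "adjacent E (p ` {2..l}) {v}"
      using l unfolding adjacent_def by force+
    moreover have "p (k + 1) \<notin> p ` {2..l}" "p 1 \<notin> p ` {2..l}"
        "p k \<notin> p ` {2..l}"
      "v \<notin> p ` {2..l}"
      using l by auto
    ultimately show False
      using no_four_star[of "p ` {2..l}" "{p (k + 1)}" "{p 1}" "{p k}" "{v}"] l N_eq by auto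
  qed
  ultimately show ?thesis by blast
qed

lemma path_or_delta:
  assumes "induced_connected E W" "W \<subseteq> V" "finite W"
  shows "(\<exists>p m. parametrizes E W p m (path_edges m)) \<or>
         (\<exists>p k. k \<ge> 2 \<and> parametrizes E W p (k + 1) (delta_edges k))"
  using assms
proof (induction "card W" arbitrary: W rule: less_induct)
  case less
  show ?case
  proof (cases "card W \<ge> 2")
    case False
    then have "card W = 1"
      using less.prems induced_connected_nonempty by (metis One_nat_def card_0_eq less_2_cases not_le)
    then obtain w where "W = {w}" by (auto simp: card_1_singleton_iff)
    then have "parametrizes E W (\<lambda>_. w) 1 (path_edges 1)"
      using loopless path_edges_iff[of 1 1 1] by (simp add: parametrizes_def bij_betw_def)
    then show ?thesis by blast
  next
    case True
    obtain v where v: "v \<in> W" and conn: "induced_connected E (W - {v})"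
      using induced_connected_remove_vertex[OF less.prems(3,1) True] by blast
    let ?U = "W - {v}"
    have vV: "v \<in> V" and vU: "v \<notin> ?U" and UV: "?U \<subseteq> V" and W: "insert v ?U = W"
      using v less.prems by auto
    have "adjacent E {v} ?U"
      using less.prems(1) v conn induced_connected_nonempty[OF conn]
      by (intro induced_connected_Un_adjacent) (auto simp: insert_absorb)
    then obtain u where u: "u \<in> ?U" "{v, u} \<in> E" by (auto simp: adjacent_def)
    have N_ne: "{i \<in> {1..m}. {v, p i} \<in> E} \<noteq> {}" if "parametrizes E ?U p m F" for p m F
    proof -
      have "u \<in> p ` {1..m}" using u(1) parametrizes_image[OF that] by simp
      then show ?thesis using u(2) by blast
    qed
    have "card ?U < card W" using v less.prems(3) by (rule card_Diff1_less[rotated])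
    then consider p m where "parametrizes E ?U p m (path_edges m)"
      | p k where "k \<ge> 2" "parametrizes E ?U p (k + 1) (delta_edges k)"
      using less.hyps[OF _ conn UV] less.prems(3) by blast
    then show ?thesis
    proof cases
      case (1 p m)
      \<comment> \<open>Two of the four attachments suffice: {m} prolongs the path and {1, 2}
        creates a triangle. The other two are their mirror images and are reached by reversing the
        labelling.\<close>
      have ends: "(\<exists>p m. parametrizes E W p m (path_edges m)) \<or>
         (\<exists>p k. k \<ge> 2 \<and> parametrizes E W p (k + 1) (delta_edges k))"
        if "{i \<in> {1..m}. {v, p i} \<in> E} \<in> {{m}, {1, 2}}" "parametrizes E ?U p m (path_edges m)" for p
      proof (cases "{i \<in> {1..m}. {v, p i} \<in> E} = {m}")
        case True
        then show ?thesis
          using parametrizes_extend_path[OF that(2) vU loopless] W by auto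
      next
        case False
        then have N: "{i \<in> {1..m}. {v, p i} \<in> E} = {1, 2}" using that by blast
        then have "2 \<in> {1..m}" by blast
        then show ?thesis
          using parametrizes_extend_path_delta[OF that(2) vU loopless _ N] W by auto
      qed
      let ?N = "{i \<in> {1..m}. {v, p i} \<in> E}"
      let ?r = "\<lambda>i. p (m + 1 - i)"
      have rev: "{i \<in> {1..m}. {v, ?r i} \<in> E} = (\<lambda>i. m + 1 - i) ` ?N"
      proof -
        have "i \<in> (\<lambda>i. m + 1 - i) ` ?N" if "i \<in> {1..m}" "{v, ?r i} \<in> E" for i
          using that by (intro image_eqI[of _ _ "m + 1 - i"]) auto
        then show ?thesis by auto
      qed
      have "?N = {1} \<or> ?N = {m} \<or> ?N = {1, 2} \<or> ?N = {m - 1, m}"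
        by (rule path_attachment[OF 1 UV vV vU refl N_ne[OF 1]])
      then show ?thesis
      proof (elim disjE)
        assume "?N = {1}"
        then have "{i \<in> {1..m}. {v, ?r i} \<in> E} = {m}" using rev by simp
        then show ?thesis using ends[OF _ parametrizes_rev_path[OF 1]] by blast
      next
        assume N: "?N = {m - 1, m}"
        then have "m - 1 \<in> {1..m}" by blast
        then have "{i \<in> {1..m}. {v, ?r i} \<in> E} = {1, 2}" using rev N by auto
        then show ?thesis using ends[OF _ parametrizes_rev_path[OF 1]] by blast
      qed (use ends[OF _ 1] in blast)+
    next
      case (2 p k)
      let ?N = "{i \<in> {1..k + 1}. {v, p i} \<in> E}"
      have "\<exists>p. parametrizes E ?U p (k + 1) (delta_edges k) \<and> {i \<in> {1..k + 1}. {v, p i} \<in> E} = {k}"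
      proof (cases "k \<ge> 3")
        case True
        then show ?thesis
          using delta_attachment[OF 2(2) True UV vV vU refl N_ne[OF 2(2)]] 2(2) by blast
      next
        case False
        then have k: "k = 2" using 2(1) by simp
        then have p: "parametrizes E ?U p 3 (delta_edges 2)" using 2(2) by simp
        obtain a where a: "a \<in> {1..3}" "{v, p a} \<in> E" using N_ne[OF p] by blast
        have unique: "b = a" if b: "b \<in> {1..3}" "{v, p b} \<in> E" for b
        proof (rule ccontr)
          assume "b \<noteq> a"
          \<comment> \<open>The third vertex of the triangle, as 1 + 2 + 3 = 6.\<close>
          define c where "c = 6 - a - b"
          have c: "c \<in> {1..3}" "c \<noteq> a" "c \<noteq> b"
            using a(1) b(1) \<open>b \<noteq> a\<close> unfolding c_def atLeastAtMost_iff by presburger+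
          have mem: "p a \<in> V" "p b \<in> V" "p c \<in> V" "p a \<noteq> v" "p b \<noteq> v"
              "p c \<noteq> v"
            using parametrizes_mem[OF p a(1)] parametrizes_mem[OF p b(1)] parametrizes_mem[OF p c(1)]
              UV by auto
          have neq: "p a \<noteq> p b" "p a \<noteq> p c" "p b \<noteq> p c"
            using parametrizes_eq[OF p] a b c \<open>b \<noteq> a\<close> by auto
          have edges: "{p a, p c} \<in> E" "{p c, p b} \<in> E" "{p b, v} \<in> E"
            using parametrizes_edge[OF p] delta_edges_2_iff a b c by (auto simp: insert_commute)
          show False
            by (rule no_four_cycle[of "{v}" "{p a}" "{p c}" "{p b}"])
              (use mem neq edges a vV in \<open>auto intro: part_singleton\<close>)
        qed
        \<comment> \<open>By the symmetry of the triangle the only neighbour of \<open>v\<close> may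
          be given the label k = 2, where \<open>parametrizes_extend_delta\<close> expects
          it.\<close>
        let ?q = "\<lambda>i. if i = a then 2 else if i = 2 then a else i"
        have "bij_betw ?q {1..3} {1..3}"
          by (rule bij_betw_byWitness[where f' = ?q]) (use a in auto)
        then have "parametrizes E ?U (p \<circ> ?q) 3 (delta_edges 2)"
        proof (rule parametrizes_compose[OF p])
          fix i j :: nat assume ij: "i \<in> {1..3}" "j \<in> {1..3}"
          then have "?q i \<in> {1..3}" "?q j \<in> {1..3}" using a by auto
          then show "{?q i, ?q j} \<in> delta_edges 2 \<longleftrightarrow> {i, j} \<in> delta_edges 2"
            using ij by (simp only: delta_edges_2_iff) auto
        qed
        moreover have "{i \<in> {1..3}. {v, (p \<circ> ?q) i} \<in> E} = {2}"
        proof (intro equalityI subsetI)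
          fix i assume "i \<in> {i \<in> {1..3}. {v, (p \<circ> ?q) i} \<in> E}"
          then have "?q i = a" using a by (intro unique) auto
          then show "i \<in> {2}" by (auto split: if_splits)
        qed (use a in auto)
        ultimately have "\<exists>p. parametrizes E ?U p 3 (delta_edges 2) \<and> {i \<in> {1..3}. {v, p i} \<in> E} = {2}"
          by blast
        then show ?thesis using k by simp
      qed
      then obtain q where "parametrizes E ?U q (k + 1) (delta_edges k)"
        "{i \<in> {1..k + 1}. {v, q i} \<in> E} = {k}" by blast
      from parametrizes_extend_delta[OF this(1) vU loopless 2(1) this(2)] W 2(1)
      show ?thesis by (metis le_add1 le_trans)
    qed
  qed
qed

end

section \<open>From nice partitions to colourings\<close>

definition connected_sets :: "nat \<Rightarrow> nat set set \<Rightarrow> nat set set" where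
  "connected_sets n E = {I. I \<subseteq> {1..n} \<and> induced_connected E I}"

lemma connected_setsD:
  assumes "I \<in> connected_sets n E"
  shows "I \<subseteq> {1..n}" "I \<noteq> {}" "finite I" "induced_connected E I"
  using assms induced_connected_nonempty finite_subset[of I "{1..n}"]
  by (auto simp: connected_sets_def)

lemma conn_subgraph_arr_eq: "conn_subgraph_arr n E = hypI n ` connected_sets n E"
  unfolding conn_subgraph_arr_def connected_sets_def using induced_connected_nonempty by fast

lemma mem_hypI:
  assumes "I \<subseteq> {1..n}"
  shows "v \<in> hypI n I \<longleftrightarrow> v \<in> vspace n \<and> sum v I = 0"
proof -
  have "(\<Sum>i\<in>{1..n}. (if i \<in> I then 1 else 0) * v i) = (\<Sum>i\<in>{1..n}. if i \<in> I then v i else 0)"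
    by (rule sum.cong) auto
  also have "\<dots> = sum v I"
    using assms by (simp add: sum.inter_restrict[symmetric] Int_absorb1)
  finally show ?thesis by (auto simp: hypI_def kernel_of_def)
qed

definition unit_vector :: "nat \<Rightarrow> nat \<Rightarrow> rat" where
  "unit_vector i k = (if k = i then 1 else 0)"

lemma unit_vector_mem_vspace: "i \<in> {1..n} \<Longrightarrow> unit_vector i \<in> vspace n"
  by (auto simp: vspace_def unit_vector_def)

lemma sum_unit_vector: "finite I \<Longrightarrow> sum (unit_vector i) I = of_bool (i \<in> I)"
  by (simp add: unit_vector_def)

lemma inj_on_hypI: "inj_on (hypI n) {I. I \<subseteq> {1..n}}"
proof -
  have sub: "I \<subseteq> J" if "hypI n I = hypI n J" "I \<subseteq> {1..n}" "J \<subseteq> {1..n}" for I J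
  proof
    fix i assume i: "i \<in> I"
    have fin: "finite I" "finite J" using that finite_subset by blast+
    have "unit_vector i \<notin> hypI n I"
      using i that mem_hypI[of I n "unit_vector i"] sum_unit_vector[OF fin(1), of i] by simp
    then have "sum (unit_vector i) J \<noteq> 0"
      using that i unit_vector_mem_vspace[of i n] mem_hypI[of J n "unit_vector i"] by auto
    then show "i \<in> J" using sum_unit_vector[OF fin(2), of i] by (auto split: if_splits)
  qed
  show ?thesis by (rule inj_onI, rule equalityI; rule sub) auto
qed

lemma defining_form_indicator:
  assumes "I \<subseteq> {1..n}" "I \<noteq> {}"
  shows "defining_form n (hypI n I) (\<lambda>i. if i \<in> I then 1 else 0)"
proof -
  obtain i where "i \<in> I" using assms by blast
  then have "(\<lambda>i. if i \<in> I then 1 else 0) \<noteq> (\<lambda>_. 0 :: rat)" by (auto dest: fun_cong[of _ _ i])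
  then show ?thesis using assms by (auto simp: defining_form_def vspace_def hypI_def)
qed

text \<open>Every vector of the flat has sum zero over \<open>K\<close>. The test vectors, written
  with unit vectors e, are e_i with i outside \<open>I \<union> J\<close>, e_i - e_j with i, j in
  the same cell of the Venn diagram, and e_i + e_j - e_l with one index from each of
  \<open>I - J\<close>, \<open>J - I\<close>, \<open>I \<inter> J\<close>.\<close>

lemma rank2_flat:
  assumes sub: "I \<subseteq> {1..n}" "J \<subseteq> {1..n}" "K \<subseteq> {1..n}"
    and X: "hypI n I \<inter> hypI n J \<subseteq> hypI n K"
  shows "K \<subseteq> I \<union> J"
    and "\<lbrakk>i \<in> {1..n}; j \<in> {1..n}; i \<in> I \<longleftrightarrow> j \<in> I; i \<in> J \<longleftrightarrow> j \<in> J\<rbrakk> \<Longrightarrow> i \<in> K \<longleftrightarrow> j \<in> K"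
    and "\<lbrakk>i \<in> I - J; j \<in> J - I; l \<in> I \<inter> J; i \<in> K; j \<in> K\<rbrakk> \<Longrightarrow> False"
    and "\<lbrakk>i \<in> I - J; j \<in> J - I; l \<in> I \<inter> J; i \<in> K \<or> j \<in> K\<rbrakk> \<Longrightarrow> l \<in> K"
    and "\<lbrakk>i \<in> I - J; j \<in> J - I; l \<in> I \<inter> J; l \<in> K\<rbrakk> \<Longrightarrow> i \<in> K \<or> j \<in> K"
proof -
  have fin: "finite I" "finite J" "finite K" using sub finite_subset by blast+
  have *: "sum v K = 0" if "v \<in> vspace n" "sum v I = 0" "sum v J = 0" for v
    using X that sub by (auto simp: mem_hypI subset_iff)
  show "K \<subseteq> I \<union> J"
  proof
    fix i assume i: "i \<in> K"
    then have "i \<in> {1..n}" using sub by blast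
    from *[OF unit_vector_mem_vspace[OF this]] show "i \<in> I \<union> J"
      using i fin by (auto simp: sum_unit_vector)
  qed
  show "i \<in> K \<longleftrightarrow> j \<in> K" if "i \<in> {1..n}" "j \<in> {1..n}"
      "i \<in> I \<longleftrightarrow> j \<in> I" "i \<in> J \<longleftrightarrow> j \<in> J"
  proof -
    have "(\<lambda>k. unit_vector i k - unit_vector j k) \<in> vspace n"
      using that by (auto simp: vspace_def unit_vector_def)
    from *[OF this] show ?thesis
      using that fin by (auto simp: sum_subtractf sum_unit_vector split: if_splits)
  qed
  have triple: "of_bool (i \<in> K) + of_bool (j \<in> K) = (of_bool (l \<in> K) :: rat)"
    if "i \<in> I - J" "j \<in> J - I" "l \<in> I \<inter> J"
  proof -
    have "(\<lambda>k. unit_vector i k + unit_vector j k - unit_vector l k) \<in> vspace n"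
      using that sub by (auto simp: vspace_def unit_vector_def)
    from *[OF this] show ?thesis
      using that fin by (simp add: sum_subtractf sum.distrib sum_unit_vector)
  qed
  show False if "i \<in> I - J" "j \<in> J - I" "l \<in> I \<inter> J" "i \<in> K" "j \<in> K"
    using triple[OF that(1-3)] that(4,5) by (cases "l \<in> K") auto
  show "l \<in> K" if "i \<in> I - J" "j \<in> J - I" "l \<in> I \<inter> J"
      "i \<in> K \<or> j \<in> K"
    using triple[OF that(1-3)] that(4) by (cases "l \<in> K"; cases "i \<in> K"; cases "j \<in> K") auto
  show "i \<in> K \<or> j \<in> K" if "i \<in> I - J" "j \<in> J - I" "l \<in> I \<inter> J"
      "l \<in> K"
    using triple[OF that(1-3)] that(4) by (cases "i \<in> K"; cases "j \<in> K") auto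
qed

text \<open>The indicator of \<open>K\<close> is constant on the three cells, with values satisfying
  a + b = c; the nonzero solutions with values 0 and 1 are the indicators of \<open>I\<close> and
  \<open>J\<close>.\<close>

lemma rank2_flat_crossing:
  assumes sub: "I \<subseteq> {1..n}" "J \<subseteq> {1..n}" "K \<subseteq> {1..n}"
    and X: "hypI n I \<inter> hypI n J \<subseteq> hypI n K" and "K \<noteq> {}"
    and cross: "I \<inter> J \<noteq> {}" "\<not> I \<subseteq> J" "\<not> J \<subseteq> I"
  shows "K = I \<or> K = J"
proof -
  note flat = rank2_flat[OF sub X]
  obtain i j l where ijl: "i \<in> I - J" "j \<in> J - I" "l \<in> I \<inter> J" using cross by blast
  have cells: "x \<in> K \<longleftrightarrow> y \<in> K" if "x \<in> I \<union> J" "y \<in> I \<union> J" "x \<in> I \<longleftrightarrow> y \<in> I" "x \<in> J \<longleftrightarrow> y \<in> J" for x y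
    using flat(2)[of x y] that sub by blast
  have K: "x \<in> K \<longleftrightarrow> x \<in> I - J \<and> i \<in> K \<or> x \<in> J - I \<and> j \<in> K \<or> x \<in> I \<inter> J \<and> l \<in> K" for x
    using flat(1) cells[of x i] cells[of x j] cells[of x l] ijl by blast
  show ?thesis
    using flat(3-5)[OF ijl] K \<open>K \<noteq> {}\<close> by blast
qed

lemma rank2_flat_disjoint:
  assumes sub: "I \<subseteq> {1..n}" "J \<subseteq> {1..n}" "K \<subseteq> {1..n}"
    and X: "hypI n I \<inter> hypI n J \<subseteq> hypI n K" and "K \<noteq> {}" and disj: "I \<inter> J = {}"
  shows "K = I \<or> K = J \<or> K = I \<union> J"
proof -
  note flat = rank2_flat[OF sub X]
  have "x \<in> K \<longleftrightarrow> y \<in> K" if "x \<in> I \<union> J" "y \<in> I \<union> J" "x \<in> I \<longleftrightarrow> y \<in> I" "x \<in> J \<longleftrightarrow> y \<in> J" for x y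
    using flat(2)[of x y] that sub by blast
  then have "I \<subseteq> K \<or> I \<inter> K = {}" "J \<subseteq> K \<or> J \<inter> K = {}" using disj by blast+
  then show ?thesis using flat(1) \<open>K \<noteq> {}\<close> by blast
qed

text \<open>Reduces the flat of a nested pair to that of a disjoint pair, the smaller set and the
  difference.\<close>

lemma hypI_Int_Un:
  assumes "I \<subseteq> {1..n}" "J \<subseteq> {1..n}" "I \<inter> J = {}"
  shows "hypI n I \<inter> hypI n (I \<union> J) = hypI n I \<inter> hypI n J"
proof -
  have "finite I" "finite J" using assms finite_subset by blast+
  then have "sum v (I \<union> J) = sum v I + sum v J" for v :: "nat \<Rightarrow> rat"
    using assms(3) by (rule sum.union_disjoint)
  then show ?thesis using assms by (auto simp: mem_hypI)
qed

text \<open>Both conclusions are instances of niceness: the singleton condition at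
  \<open>hypI n I \<inter> hypI n J\<close>, and the independence condition for a choice of
  hyperplanes that would contain all three of \<open>I\<close>, \<open>J\<close>,
  \<open>I \<union> J\<close> if their colours were distinct.\<close>

lemma nice_partition_coloring:
  assumes P: "nice_partition n (hypI n ` C) P" and C: "\<And>I. I \<in> C \<Longrightarrow> I \<subseteq> {1..n} \<and> I \<noteq> {}"
  obtains col :: "nat set \<Rightarrow> nat" where
    "\<And>I J. I \<in> C \<Longrightarrow> J \<in> C \<Longrightarrow>
      \<exists>i. card {K \<in> C. hypI n I \<inter> hypI n J \<subseteq> hypI n K \<and> col K = i} = 1"
    "\<And>I J. \<lbrakk>I \<in> C; J \<in> C; I \<union> J \<in> C; I \<inter> J = {}\<rbrakk> \<Longrightarrow>
      col I = col J \<or> col I = col (I \<union> J) \<or> col J = col (I \<union> J)"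
proof -
  have isP: "is_partition (hypI n ` C) P" using P by (simp add: nice_partition_def)
  have indep: "forms_lin_indep n (length P) f"
    if "\<forall>i<length P. h i \<in> P ! i \<and> defining_form n (h i) (f i)" for h f
    using P that unfolding nice_partition_def by blast
  have part: "P ! i \<noteq> {}" "P ! i \<subseteq> hypI n ` C" if "i < length P" for i
    using isP nth_mem[OF that] that unfolding is_partition_def by blast+
  have disj: "i = j" if "i < length P" "j < length P" "H \<in> P ! i" "H \<in> P ! j" for i j H
    using isP that unfolding is_partition_def by blast
  have cover: "\<exists>i<length P. hypI n I \<in> P ! i" if "I \<in> C" for I
  proof -
    have "hypI n I \<in> \<Union> (set P)" using isP that by (simp add: is_partition_def)
    then show ?thesis by (auto simp: in_set_conv_nth)
  qed
  define col where "col I = (THE i. i < length P \<and> hypI n I \<in> P ! i)" for I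
  have colI: "col I = i" if "i < length P" "hypI n I \<in> P ! i" for I i
    unfolding col_def using that disj by blast
  have col: "col I < length P" "hypI n I \<in> P ! col I" if "I \<in> C" for I
    using cover[OF that] colI by auto
  show thesis
  proof (rule that[of col])
    fix I J assume IJ: "I \<in> C" "J \<in> C"
    let ?X = "hypI n I \<inter> hypI n J"
    have "?X \<in> int_lattice n (hypI n ` C)"
      unfolding int_lattice_def using IJ C
      by (auto intro!: exI[of _ "{hypI n I, hypI n J}"] simp: mem_hypI)
    moreover have "?X \<noteq> vspace n"
    proof
      assume X: "?X = vspace n"
      obtain i where i: "i \<in> I" using C IJ by blast
      then have "unit_vector i \<in> hypI n I"
        using X unit_vector_mem_vspace[of i n] C[OF IJ(1)] by blast
      moreover have "finite I" using C[OF IJ(1)] finite_subset by blast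
      ultimately show False
        using i C[OF IJ(1)] by (simp add: mem_hypI sum_unit_vector)
    qed
    ultimately obtain i where i: "i < length P"
        "card (P ! i \<inter> localization (hypI n ` C) ?X) = 1"
      using P unfolding nice_partition_def by blast
    have "P ! i \<inter> localization (hypI n ` C) ?X = hypI n ` {K \<in> C. ?X \<subseteq> hypI n K \<and> col K = i}"
      using colI[OF i(1)] col by (auto simp: localization_def)
    moreover have "inj_on (hypI n) {K \<in> C. ?X \<subseteq> hypI n K \<and> col K = i}"
      by (rule inj_on_subset[OF inj_on_hypI]) (use C in blast)
    ultimately have "card {K \<in> C. ?X \<subseteq> hypI n K \<and> col K = i} = 1"
      using i(2) by (simp add: card_image)
    then show "\<exists>i. card {K \<in> C. ?X \<subseteq> hypI n K \<and> col K = i} = 1" ..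
  next
    fix I J assume IJ: "I \<in> C" "J \<in> C" "I \<union> J \<in> C" "I \<inter> J = {}"
    show "col I = col J \<or> col I = col (I \<union> J) \<or> col J = col (I \<union> J)"
    proof (rule ccontr)
      assume neq: "\<not> ?thesis"
      \<comment> \<open>One set per block: the three given sets in their own blocks, an arbitrary
        member elsewhere.\<close>
      define K where "K i = (if i = col I then I else if i = col J then J else
        if i = col (I \<union> J) then I \<union> J else SOME K. K \<in> C \<and> hypI n K \<in> P ! i)" for i
      have K: "K i \<in> C \<and> hypI n (K i) \<in> P ! i" if "i < length P" for i
      proof -
        have "\<exists>K. K \<in> C \<and> hypI n K \<in> P ! i" using part[OF that] by blast
        then show ?thesis using someI_ex[of "\<lambda>K. K \<in> C \<and> hypI n K \<in> P ! i"] IJ col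
          by (auto simp: K_def)
      qed
      define f :: "nat \<Rightarrow> nat \<Rightarrow> rat" where "f i = (\<lambda>j. if j \<in> K i then 1 else 0)" for i
      have "defining_form n (hypI n (K i)) (f i)" if "i < length P" for i
        unfolding f_def using K[OF that] C by (intro defining_form_indicator) blast+
      then have "forms_lin_indep n (length P) f"
        using indep[of "\<lambda>i. hypI n (K i)" f] K by blast
      \<comment> \<open>The coefficients 1, 1, -1 express that the indicators of \<open>I\<close>
        and \<open>J\<close> add up to that of \<open>I \<union> J\<close>.\<close>
      moreover define c :: "nat \<Rightarrow> rat" where
        "c i = of_bool (i = col I) + of_bool (i = col J) - of_bool (i = col (I \<union> J))" for i
      have "(\<Sum>i<length P. c i * f i j) = 0" for j
      proof -
        have "(\<Sum>i<length P. c i * f i j) =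
          (\<Sum>i<length P. if i = col I then f i j else 0) + (\<Sum>i<length P. if i = col J then f i j else 0)
          - (\<Sum>i<length P. if i = col (I \<union> J) then f i j else 0)"
          unfolding sum.distrib[symmetric] sum_subtractf[symmetric] c_def
          by (rule sum.cong) auto
        also have "\<dots> = f (col I) j + f (col J) j - f (col (I \<union> J)) j"
          using col IJ by simp
        also have "\<dots> = 0"
          using neq IJ(4) by (auto simp: f_def K_def)
        finally show ?thesis .
      qed
      ultimately have "c (col I) = 0"
        using col(1)[OF IJ(1)] unfolding forms_lin_indep_def by blast
      then show False using neq by (simp add: c_def)
    qed
  qed
qed

lemma factored_imp_rank2_coloring:
  assumes "factored n (conn_subgraph_arr n E)" and loopless: "\<And>v. {v} \<notin> E"
  obtains col where "rank2_coloring E {1..n} col"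
proof -
  let ?C = "connected_sets n E"
  obtain P where P: "nice_partition n (hypI n ` ?C) P"
    using assms(1) by (auto simp: factored_def conn_subgraph_arr_eq)
  have C: "I \<subseteq> {1..n} \<and> I \<noteq> {}" if "I \<in> ?C" for I
    using connected_setsD[OF that] by blast
  have memC: "I \<in> ?C \<longleftrightarrow> I \<subseteq> {1..n} \<and> induced_connected E I" for I
    by (simp add: connected_sets_def)
  obtain col :: "nat set \<Rightarrow> nat" where
    single: "\<And>I J. I \<in> ?C \<Longrightarrow> J \<in> ?C \<Longrightarrow>
      \<exists>i. card {K \<in> ?C. hypI n I \<inter> hypI n J \<subseteq> hypI n K \<and> col K = i} = 1"
    and dep: "\<And>I J. \<lbrakk>I \<in> ?C; J \<in> ?C; I \<union> J \<in> ?C; I \<inter> J = {}\<rbrakk> \<Longrightarrow>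
      col I = col J \<or> col I = col (I \<union> J) \<or> col J = col (I \<union> J)"
    using nice_partition_coloring[OF P C] by blast
  \<comment> \<open>If all hyperplanes through the flat share one colour, the only block meeting it
    contains both \<open>I\<close> and \<open>J\<close>, so no block meets it in exactly one
    hyperplane.\<close>
  have not_mono: False
    if IJ: "I \<in> ?C" "J \<in> ?C" "I \<noteq> J"
      and flat: "\<And>K. K \<in> ?C \<Longrightarrow> hypI n I \<inter> hypI n J \<subseteq> hypI n K \<Longrightarrow> col K = col I"
      and "col J = col I" for I J
  proof -
    obtain i L where L: "{K \<in> ?C. hypI n I \<inter> hypI n J \<subseteq> hypI n K \<and> col K = i} = {L}"
      using single[OF IJ(1,2)] by (auto simp: card_1_singleton_iff)
    then have "L \<in> ?C" "hypI n I \<inter> hypI n J \<subseteq> hypI n L" "col L = i" by auto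
    then have "i = col I" using flat by blast
    then have "I \<in> {L}" "J \<in> {L}" unfolding L[symmetric] using IJ \<open>col J = col I\<close> by auto
    then show False using IJ(3) by simp
  qed
  have "rank2_coloring E {1..n} col"
  proof
    show "{v} \<notin> E" for v by (rule loopless)
  next
    fix I J
    assume "induced_connected E I" "induced_connected E J" "I \<subseteq> {1..n}"
        "J \<subseteq> {1..n}"
      and cross: "I \<inter> J \<noteq> {}" "\<not> I \<subseteq> J" "\<not> J \<subseteq> I"
    then have IJ: "I \<in> ?C" "J \<in> ?C" "I \<noteq> J" by (auto simp: memC)
    show "col I \<noteq> col J"
    proof
      assume eq: "col I = col J"
      have "col K = col I" if "K \<in> ?C" "hypI n I \<inter> hypI n J \<subseteq> hypI n K" for K
        using rank2_flat_crossing[of I n J K] C[OF IJ(1)] C[OF IJ(2)] C[OF that(1)] that(2) cross eq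
        by auto
      then show False using not_mono[OF IJ _ eq[symmetric]] by blast
    qed
  next
    fix I J
    assume "induced_connected E I" "induced_connected E J" "I \<subseteq> {1..n}"
        "J \<subseteq> {1..n}"
      and disj: "I \<inter> J = {}" and nc: "\<not> induced_connected E (I \<union> J)"
    then have IJ: "I \<in> ?C" "J \<in> ?C" "I \<union> J \<notin> ?C" by (auto simp: memC)
    have "I \<noteq> J" using C[OF IJ(1)] disj by blast
    show "col I \<noteq> col J"
    proof
      assume eq: "col I = col J"
      have "col K = col I" if "K \<in> ?C" "hypI n I \<inter> hypI n J \<subseteq> hypI n K" for K
        using rank2_flat_disjoint[of I n J K] C[OF IJ(1)] C[OF IJ(2)] C[OF that(1)] that disj eq IJ(3)
        by auto
      then show False using not_mono[OF IJ(1,2) \<open>I \<noteq> J\<close>] eq by metis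
    qed
  next
    fix I J
    assume "induced_connected E I" "induced_connected E J" "J \<subseteq> {1..n}" and sub: "I \<subset> J"
      and nc: "\<not> induced_connected E (J - I)"
    then have IJ: "I \<in> ?C" "J \<in> ?C" "J - I \<notin> ?C" by (auto simp: memC)
    have "hypI n I \<inter> hypI n J = hypI n I \<inter> hypI n (J - I)"
      using hypI_Int_Un[of I n "J - I"] sub \<open>J \<subseteq> {1..n}\<close> by (auto simp: Un_absorb1)
    then have flat: "K = I \<or> K = J - I \<or> K = J"
      if "K \<in> ?C" "hypI n I \<inter> hypI n J \<subseteq> hypI n K" for K
      using rank2_flat_disjoint[of I n "J - I" K] C[OF that(1)] that sub \<open>J \<subseteq> {1..n}\<close>
      by (auto simp: Un_absorb1)
    show "col I \<noteq> col J"
    proof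
      assume eq: "col I = col J"
      have "col K = col I" if "K \<in> ?C" "hypI n I \<inter> hypI n J \<subseteq> hypI n K" for K
        using flat[OF that] that(1) IJ(3) eq by auto
      then show False using not_mono[OF IJ(1,2) _ _ eq[symmetric]] sub by blast
    qed
  next
    fix I J K
    assume "induced_connected E I" "induced_connected E J" "induced_connected E K"
        "K \<subseteq> {1..n}"
      and disj: "I \<inter> J = {}" and K: "K = I \<union> J"
    then have IJ: "I \<in> ?C" "J \<in> ?C" "I \<union> J \<in> ?C" by (auto simp: memC)
    have "I \<noteq> J" using C[OF IJ(1)] disj by blast
    have "\<not> (col J = col I \<and> col K = col I)"
    proof
      assume eq: "col J = col I \<and> col K = col I"
      have "col L = col I" if "L \<in> ?C" "hypI n I \<inter> hypI n J \<subseteq> hypI n L" for L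
        using rank2_flat_disjoint[of I n J L] C[OF IJ(1)] C[OF IJ(2)] C[OF that(1)] that(2) disj eq K
        by auto
      then show False using not_mono[OF IJ(1,2) \<open>I \<noteq> J\<close>] eq by metis
    qed
    then show "two_colored (col I) (col J) (col K)"
      using dep[OF IJ disj] K unfolding two_colored_def by auto
  qed
  then show thesis by (rule that)
qed

section \<open>From blocks of connected sets to nice partitions\<close>

text \<open>For a set \<open>X\<close> of points, the sets in the blocks whose coordinate sum vanishes on \<open>X\<close> form the
  localization at \<open>X\<close>.\<close>

locale nice_blocks =
  fixes V :: "nat set" and s :: nat and Q :: "nat \<Rightarrow> nat set set"
  assumes nonempty: "i < s \<Longrightarrow> Q i \<noteq> {}"
    and subset: "i < s \<Longrightarrow> I \<in> Q i \<Longrightarrow> I \<subseteq> V"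
    and disjoint: "i < s \<Longrightarrow> j < s \<Longrightarrow> i \<noteq> j \<Longrightarrow> Q i \<inter> Q j = {}"
    and independent: "\<lbrakk>\<And>i. i < s \<Longrightarrow> h i \<in> Q i;
      \<And>j. j \<in> V \<Longrightarrow> (\<Sum>i<s. (c i :: rat) * of_bool (j \<in> h i)) = 0; i < s\<rbrakk> \<Longrightarrow> c i = 0"
    and singleton: "\<lbrakk>i < s; I \<in> Q i; \<forall>x\<in>X. sum x I = (0 :: rat)\<rbrakk>
      \<Longrightarrow> \<exists>i<s. \<exists>J. {K \<in> Q i. \<forall>x\<in>X. sum x K = 0} = {J}"

lemma sum_mult_unit_vector:
  "i \<in> {1..n} \<Longrightarrow> (\<Sum>k\<in>{1..n}. f k * unit_vector i k) = f i"
  by (simp add: unit_vector_def if_distrib cong: if_cong)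

text \<open>Niceness quantifies over all defining forms. Evaluating at e_j for j outside
  \<open>I\<close> and at e_j - e_i inside shows that the form is a multiple of the indicator, and
  the factor can be absorbed into the coefficients of a linear relation.\<close>

lemma defining_form_hypI:
  assumes f: "defining_form n (hypI n I) f" and I: "I \<subseteq> {1..n}" "I \<noteq> {}"
  obtains a where "a \<noteq> 0" "\<And>j. f j = a * of_bool (j \<in> I)"
proof -
  have fin: "finite I" using I finite_subset by blast
  have eq: "hypI n I = kernel_of n f" and fV: "f \<in> vspace n" and nz: "f \<noteq> (\<lambda>_. 0)"
    using f by (auto simp: defining_form_def)
  obtain i where i: "i \<in> I" using I by blast
  have out: "f j = 0" if "j \<notin> I" for j
  proof (cases "j \<in> {1..n}")
    case True
    then have "unit_vector j \<in> hypI n I"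
      using that I fin by (simp add: mem_hypI unit_vector_mem_vspace sum_unit_vector)
    then show ?thesis using sum_mult_unit_vector[OF True] by (simp add: eq kernel_of_def)
  qed (use fV in \<open>auto simp: vspace_def\<close>)
  have ins: "f j = f i" if "j \<in> I" for j
  proof -
    have ij: "i \<in> {1..n}" "j \<in> {1..n}" using i that I by auto
    let ?d = "\<lambda>k. unit_vector j k - unit_vector i k"
    have "?d \<in> hypI n I"
      using I fin i that ij
      by (auto simp: mem_hypI sum_subtractf sum_unit_vector vspace_def unit_vector_def)
    then show ?thesis
      using sum_mult_unit_vector[OF ij(1), of f] sum_mult_unit_vector[OF ij(2), of f]
      by (simp add: eq kernel_of_def right_diff_distrib sum_subtractf)
  qed
  have f_eq: "f j = f i * of_bool (j \<in> I)" for j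
    using out ins by simp
  moreover have "f i \<noteq> 0"
  proof
    assume "f i = 0"
    then have "f j = 0" for j using f_eq[of j] by simp
    then show False using nz by blast
  qed
  ultimately show thesis by (rule that[rotated])
qed

lemma nice_blocks_imp_factored:
  assumes Q: "nice_blocks {1..n} s Q" and C: "C = (\<Union>i<s. Q i)" and ne: "{} \<notin> C"
  shows "factored n (hypI n ` C)"
proof -
  define P where "P = map (\<lambda>i. hypI n ` Q i) [0..<s]"
  have nth: "P ! i = hypI n ` Q i" if "i < s" for i
    using that by (simp add: P_def)
  have len: "length P = s" by (simp add: P_def)
  have sub: "I \<subseteq> {1..n}" "I \<noteq> {}" "I \<in> C" if "i < s" "I \<in> Q i" for i I
    using nice_blocks.subset[OF Q that] that C ne by auto
  have disj: "hypI n ` Q i \<inter> hypI n ` Q j = {}" if "i < s" "j < s" "i \<noteq> j" for i j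
  proof -
    have "hypI n ` Q i \<inter> hypI n ` Q j = hypI n ` (Q i \<inter> Q j)"
      by (rule inj_on_image_Int[OF inj_on_hypI, symmetric]) (use sub that in auto)
    then show ?thesis using nice_blocks.disjoint[OF Q that] by simp
  qed
  have "is_partition (hypI n ` C) P"
    unfolding is_partition_def len
  proof (intro conjI allI impI)
    show "\<Union> (set P) = hypI n ` C" unfolding P_def C by (auto simp: image_UN)
  qed (use nth nice_blocks.nonempty[OF Q] disj in auto)
  moreover have "forms_lin_indep n (length P) f"
    if hf: "\<forall>i<length P. h i \<in> P ! i \<and> defining_form n (h i) (f i)" for h f
  proof -
    have "\<exists>g a. g \<in> Q i \<and> a \<noteq> 0 \<and> (\<forall>j. f i j = a * of_bool (j \<in> g))" if i: "i < s" for i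
    proof -
      have "h i \<in> hypI n ` Q i" using hf i nth[OF i] unfolding len by metis
      then obtain g where g: "g \<in> Q i" "h i = hypI n g" by blast
      have "defining_form n (hypI n g) (f i)" using hf i len g(2) by auto
      from defining_form_hypI[OF this] sub[OF i g(1)] g(1) show ?thesis by metis
    qed
    then obtain g a where g: "\<And>i. i < s \<Longrightarrow> g i \<in> Q i" and a: "\<And>i. i < s \<Longrightarrow> a i \<noteq> 0"
      and f: "\<And>i j. i < s \<Longrightarrow> f i j = a i * of_bool (j \<in> g i)" by metis
    show ?thesis unfolding forms_lin_indep_def len
    proof (intro allI impI)
      fix c :: "nat \<Rightarrow> rat" and i
      assume c: "\<forall>j\<in>{1..n}. (\<Sum>i<s. c i * f i j) = 0" and i: "i < s"
      have "(\<Sum>i<s. c i * a i * of_bool (j \<in> g i)) = 0" if "j \<in> {1..n}" for j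
        using c[rule_format, OF that] f by (simp add: mult.assoc)
      from nice_blocks.independent[OF Q g this i] show "c i = 0" using a[OF i] by simp
    qed
  qed
  moreover have "\<exists>i<length P. card (P ! i \<inter> localization (hypI n ` C) X) = 1"
    if X: "X \<in> int_lattice n (hypI n ` C) - {vspace n}" for X
  proof -
    obtain B where B: "X = vspace n \<inter> \<Inter> B" "B \<subseteq> hypI n ` C"
      using X by (auto simp: int_lattice_def)
    \<comment> \<open>As \<open>X\<close> is a proper subspace, some hyperplane contains it; this
      provides the member that \<open>singleton\<close> starts from.\<close>
    then have "B \<noteq> {}" using X by auto
    then obtain I where I: "I \<in> C" "hypI n I \<in> B" using B by blast
    then obtain i0 where i0: "i0 < s" "I \<in> Q i0" using C by blast
    have vanish: "(\<forall>x\<in>X. sum x J = 0) \<longleftrightarrow> X \<subseteq> hypI n J" if "J \<subseteq> {1..n}" for J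
      using B(1) that by (auto simp: mem_hypI)
    have "X \<subseteq> hypI n I" using B I by blast
    then have "\<forall>x\<in>X. sum x I = 0" using vanish sub(1)[OF i0] by blast
    from nice_blocks.singleton[OF Q i0 this]
    obtain i J where i: "i < s" and J: "{K \<in> Q i. \<forall>x\<in>X. sum x K = 0} = {J}" by (elim exE conjE)
    have "P ! i \<inter> localization (hypI n ` C) X = hypI n ` {K \<in> Q i. X \<subseteq> hypI n K}"
      unfolding nth[OF i] localization_def using sub(3)[OF i] by blast
    also have "{K \<in> Q i. X \<subseteq> hypI n K} = {J}"
      using J vanish[OF sub(1)[OF i]] by (simp cong: conj_cong)
    finally have "card (P ! i \<inter> localization (hypI n ` C) X) = 1" by simp
    then show ?thesis using i unfolding len by blast
  qed
  ultimately show ?thesis unfolding factored_def nice_partition_def by blast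
qed

lemma nice_blocks_image:
  assumes Q: "nice_blocks U s Q" and p: "bij_betw p U V"
  shows "nice_blocks V s (\<lambda>i. image p ` Q i)"
proof -
  have inj: "inj_on p U" and img: "p ` U = V" using p by (auto simp: bij_betw_def)
  have sum_p: "sum x (p ` I) = sum (x \<circ> p) I" if "I \<subseteq> U" for I and x :: "nat \<Rightarrow> rat"
    using inj_on_subset[OF inj that] by (rule sum.reindex)
  have mem_p: "p j \<in> p ` I \<longleftrightarrow> j \<in> I" if "I \<subseteq> U" "j \<in> U" for I j
    using inj that by (auto simp: inj_on_def)
  have inj_image: "p ` I = p ` J \<longleftrightarrow> I = J" if "I \<subseteq> U" "J \<subseteq> U" for I J
    using inj_on_image_eq_iff[OF inj that] .
  note sub = nice_blocks.subset[OF Q]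
  show ?thesis
  proof
    show "image p ` Q i \<inter> image p ` Q j = {}" if "i < s" "j < s" "i \<noteq> j" for i j
      using nice_blocks.disjoint[OF Q that] inj_image sub that by (auto simp: disjoint_iff)
    show "c i = 0"
      if h: "\<And>i. i < s \<Longrightarrow> h i \<in> image p ` Q i"
        and c: "\<And>j. j \<in> V \<Longrightarrow> (\<Sum>i<s. c i * of_bool (j \<in> h i)) = 0"
        and i: "i < s" for h i and c :: "nat \<Rightarrow> rat"
    proof -
      obtain g where g: "\<And>i. i < s \<Longrightarrow> g i \<in> Q i"
          "\<And>i. i < s \<Longrightarrow> h i = p ` g i"
        using h unfolding image_iff by metis
      have "(\<Sum>i<s. c i * of_bool (j \<in> g i)) = 0" if "j \<in> U" for j
      proof -
        have "(\<Sum>i<s. c i * of_bool (j \<in> g i)) = (\<Sum>i<s. c i * of_bool (p j \<in> h i))"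
          using g mem_p[OF sub that] by (intro sum.cong) auto
        then show ?thesis using c that img by auto
      qed
      from nice_blocks.independent[OF Q g(1) this i] show ?thesis .
    qed
    show "\<exists>i<s. \<exists>J. {K \<in> image p ` Q i. \<forall>x\<in>X. sum x K = 0} = {J}"
      if i: "i < s" and I: "I \<in> image p ` Q i" "\<forall>x\<in>X. sum x I = 0"
      for i I and X :: "(nat \<Rightarrow> rat) set"
    proof -
      obtain J where J: "J \<in> Q i" "I = p ` J" using I(1) by blast
      let ?Y = "(\<lambda>x. x \<circ> p) ` X"
      have van: "(\<forall>y\<in>?Y. sum y K = 0) \<longleftrightarrow> (\<forall>x\<in>X. sum x (p ` K) = 0)" if "K \<subseteq> U" for K
        using sum_p[OF that] by simp
      have "\<forall>y\<in>?Y. sum y J = 0" using van[OF sub[OF i J(1)]] I(2) J(2) by simp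
      from nice_blocks.singleton[OF Q i J(1) this]
      obtain i' K where i': "i' < s" and K: "{L \<in> Q i'. \<forall>y\<in>?Y. sum y L = 0} = {K}"
        by (elim exE conjE)
      have "{I \<in> image p ` Q i'. \<forall>x\<in>X. sum x I = 0} = image p ` {L \<in> Q i'. \<forall>y\<in>?Y. sum y L = 0}"
        using van[OF sub[OF i']] by (auto simp: image_iff cong: conj_cong)
      then show ?thesis using i' K by auto
    qed
    show "image p ` Q i \<noteq> {}" if "i < s" for i
      using nice_blocks.nonempty[OF Q that] by blast
    show "I \<subseteq> V" if "i < s" "I \<in> image p ` Q i" for i I
      using sub[OF that(1)] that(2) img by blast
  qed
qed

section \<open>Tools for the explicit partitions: independence, relabelling, intervals\<close>

text \<open>At the largest index m with nonzero coefficient, the equation at the point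
  \<open>\<tau> m\<close> reduces to c m = 0: smaller sets miss that point, larger coefficients
  vanish.\<close>

lemma triangular_coefficients:
  fixes c :: "nat \<Rightarrow> rat"
  assumes "finite L" and diag: "\<And>i. i \<in> L \<Longrightarrow> \<tau> i \<in> h i"
    and upper: "\<And>i j. i \<in> L \<Longrightarrow> j \<in> L \<Longrightarrow> j < i \<Longrightarrow> \<tau> i \<notin> h j"
    and zero: "\<And>i. i \<in> L \<Longrightarrow> (\<Sum>j\<in>L. c j * of_bool (\<tau> i \<in> h j)) = 0"
    and "i \<in> L"
  shows "c i = 0"
proof (rule ccontr)
  let ?M = "{i \<in> L. c i \<noteq> 0}"
  define m where "m = Max ?M"
  assume "c i \<noteq> 0"
  then have ne: "?M \<noteq> {}" "finite ?M" using assms by auto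
  then have m: "m \<in> L" "c m \<noteq> 0" using Max_in[of ?M] by (auto simp: m_def)
  have "c j * of_bool (\<tau> m \<in> h j) = 0" if "j \<in> L - {m}" for j
  proof (cases "j < m")
    case True
    then show ?thesis using upper that m by auto
  next
    case False
    then have "j \<notin> ?M" using Max_ge[OF ne(2), of j] that by (force simp: m_def)
    then show ?thesis using that by auto
  qed
  then have "(\<Sum>j\<in>L - {m}. c j * of_bool (\<tau> m \<in> h j)) = 0" by (intro sum.neutral) blast
  then have "(\<Sum>j\<in>L. c j * of_bool (\<tau> m \<in> h j)) = c m * of_bool (\<tau> m \<in> h m)"
    using sum.remove[OF assms(1) m(1), of "\<lambda>j. c j * of_bool (\<tau> m \<in> h j)"] by simp
  then show False using zero[OF m(1)] diag[OF m(1)] m(2) by simp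
qed

lemma induced_connected_map:
  assumes "induced_connected F S"
    and edges: "\<And>i j. i \<in> S \<Longrightarrow> j \<in> S \<Longrightarrow> {i, j} \<in> F \<Longrightarrow> {p i, p j} \<in> E"
  shows "induced_connected E (p ` S)"
proof -
  let ?R = "{(a, b). a \<in> S \<and> b \<in> S \<and> {a, b} \<in> F}"
  let ?R' = "{(a, b). a \<in> p ` S \<and> b \<in> p ` S \<and> {a, b} \<in> E}"
  have step: "(p u, p v) \<in> ?R'\<^sup>*" if "(u, v) \<in> ?R\<^sup>*" for u v
    using that
  proof induction
    case (step y z)
    then have "(p y, p z) \<in> ?R'" using edges by auto
    with step.IH show ?case by (rule rtrancl_into_rtrancl)
  qed simp
  have "(u, v) \<in> ?R\<^sup>*" if "u \<in> S" "v \<in> S" for u v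
    using assms(1) that by (simp add: induced_connected_def)
  then have "\<forall>u\<in>p ` S. \<forall>v\<in>p ` S. (u, v) \<in> ?R'\<^sup>*" using step by blast
  then show ?thesis
    using induced_connected_nonempty[OF assms(1)] unfolding induced_connected_def by blast
qed

lemma connected_sets_parametrized:
  assumes p: "parametrizes E {1..n} p m F"
  shows "connected_sets n E = image p ` connected_sets m F"
proof (intro equalityI subsetI)
  fix I assume I: "I \<in> connected_sets n E"
  let ?S = "{i \<in> {1..m}. p i \<in> I}"
  have "I \<subseteq> p ` {1..m}" using connected_setsD(1)[OF I] parametrizes_image[OF p] by simp
  then have I_eq: "I = p ` ?S" by blast
  let ?q = "inv_into {1..m} p"
  have inj: "inj_on p {1..m}" using p by (simp add: parametrizes_def bij_betw_def)
  have q: "?q (p i) = i" if "i \<in> {1..m}" for i using inv_into_f_f[OF inj that] .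
  have "induced_connected F (?q ` I)"
  proof (rule induced_connected_map)
    show "induced_connected E I" using connected_setsD(4)[OF I] .
    fix a b assume "a \<in> I" "b \<in> I" "{a, b} \<in> E"
    then obtain i j where "i \<in> {1..m}" "j \<in> {1..m}" "a = p i" "b = p j" using I_eq by blast
    then show "{?q a, ?q b} \<in> F" using q parametrizes_edge[OF p] \<open>{a, b} \<in> E\<close> by simp
  qed
  moreover have "?q ` I = ?S"
  proof -
    have "?q ` p ` ?S = ?S" using q by (force simp: image_iff)
    then show ?thesis using I_eq by simp
  qed
  ultimately have "?S \<in> connected_sets m F" by (auto simp: connected_sets_def)
  then show "I \<in> image p ` connected_sets m F" using I_eq by blast
next
  fix I assume "I \<in> image p ` connected_sets m F"
  then obtain S where S: "S \<in> connected_sets m F" "I = p ` S" by blast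
  have "induced_connected E (p ` S)"
    using connected_setsD[OF S(1)] parametrizes_edge[OF p] by (intro induced_connected_map) blast+
  moreover have "p ` S \<subseteq> {1..n}"
    using connected_setsD(1)[OF S(1)] parametrizes_image[OF p] by blast
  ultimately show "I \<in> connected_sets n E" using S by (simp add: connected_sets_def)
qed

lemma nice_blocks_imp_factored_graph:
  assumes p: "parametrizes E {1..n} p m F" and Q: "nice_blocks {1..m} s Q"
    and C: "connected_sets m F = (\<Union>i<s. Q i)"
  shows "factored n (conn_subgraph_arr n E)"
  unfolding conn_subgraph_arr_eq
proof (rule nice_blocks_imp_factored)
  show "nice_blocks {1..n} s (\<lambda>i. image p ` Q i)"
    using nice_blocks_image[OF Q] p by (simp add: parametrizes_def)
  show "connected_sets n E = (\<Union>i<s. image p ` Q i)"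
    unfolding connected_sets_parametrized[OF p] C by (simp add: image_UN)
  show "{} \<notin> connected_sets n E" using connected_setsD(2) by blast
qed

lemma induced_connected_cut:
  assumes "induced_connected E I" "A \<subseteq> I" "A \<noteq> {}" "A \<noteq> I"
  obtains x y where "x \<in> A" "y \<in> I - A" "{x, y} \<in> E"
proof -
  have "adjacent E A (I - A)"
    using assms by (intro induced_connected_Un_adjacent) (auto simp: Un_absorb1)
  then show thesis using that by (auto simp: adjacent_def)
qed

text \<open>A missing value would separate \<open>I\<close> into a lower and an upper part, and an
  edge between them would have to jump over it.\<close>

lemma induced_connected_interval:
  assumes "induced_connected E I" "finite I"
    and edges: "\<And>x y. x \<in> I \<Longrightarrow> y \<in> I \<Longrightarrow> {x, y} \<in> E \<Longrightarrow> y \<le> x + 1"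
  shows "I = {Min I..Max I}"
proof
  have ne: "I \<noteq> {}" using induced_connected_nonempty[OF assms(1)] .
  show "I \<subseteq> {Min I..Max I}" using assms(2) by auto
  show "{Min I..Max I} \<subseteq> I"
  proof
    fix j assume j: "j \<in> {Min I..Max I}"
    show "j \<in> I"
    proof (rule ccontr)
      assume "j \<notin> I"
      let ?A = "{i \<in> I. i < j}"
      have mem: "Min I \<in> I" "Max I \<in> I" using Min_in Max_in assms(2) ne by auto
      then have "Min I \<in> ?A" "Max I \<notin> ?A" using j \<open>j \<notin> I\<close> by (auto simp: less_le)
      then have "?A \<subseteq> I" "?A \<noteq> {}" "?A \<noteq> I" using mem(2) by blast+
      then obtain x y where "x \<in> ?A" "y \<in> I - ?A" "{x, y} \<in> E"
        by (rule induced_connected_cut[OF assms(1)])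
      then have "x < j" "j \<le> y" "y \<le> x + 1" "y \<in> I" using edges[of x y] by auto
      then have "y = j" by linarith
      then show False using \<open>y \<in> I\<close> \<open>j \<notin> I\<close> by simp
    qed
  qed
qed

lemma induced_connected_atLeastAtMost:
  assumes "a \<le> b" and "\<And>i. a \<le> i \<Longrightarrow> i < b \<Longrightarrow> {i, Suc i} \<in> E"
  shows "induced_connected E {a..b}"
  using induced_connected_image_atLeastAtMost[of a b id E] assms by simp

lemma sum_atLeastAtMost_split:
  fixes x :: "nat \<Rightarrow> 'a :: comm_monoid_add"
  assumes "a \<le> c" "c \<le> b"
  shows "sum x {a..b} = sum x {a..<c} + sum x {c..b}"
proof -
  have "{a..b} = {a..<c} \<union> {c..b}" using assms by auto
  moreover have "sum x ({a..<c} \<union> {c..b}) = sum x {a..<c} + sum x {c..b}"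
    by (rule sum.union_disjoint) auto
  ultimately show ?thesis by simp
qed

section \<open>The nice partition of a path\<close>

text \<open>Blocks are numbered from 0, so block i holds the right end i + 1. In prefix sums its
  forms are s_(i+1) - s_0, ..., s_(i+1) - s_i, a column of the usual partition of the braid
  arrangement.\<close>

definition path_block :: "nat \<Rightarrow> nat set set" where
  "path_block i = (\<lambda>a. {a..Suc i}) ` {1..Suc i}"

lemma path_blockD:
  assumes "I \<in> path_block i"
  shows "Suc i \<in> I" "I \<subseteq> {1..Suc i}"
  using assms by (auto simp: path_block_def)

lemma connected_sets_path: "connected_sets m (path_edges m) = (\<Union>i<m. path_block i)"
proof (intro equalityI subsetI)
  fix I assume I: "I \<in> connected_sets m (path_edges m)"
  note I' = connected_setsD[OF I]
  have eq: "I = {Min I..Max I}"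
    by (rule induced_connected_interval[OF I'(4,3)]) (auto simp: path_edges_iff)
  have "Min I \<in> I" "Max I \<in> I" "Min I \<le> Max I" using I'(2,3) by auto
  then have "1 \<le> Min I" "Max I \<le> m" "Min I \<le> Max I" using I'(1) by auto
  moreover from this obtain b where "Max I = Suc b" by (cases "Max I") auto
  ultimately have "I \<in> path_block b" "b < m"
    using eq by (auto simp: path_block_def intro: image_eqI[of _ _ "Min I"])
  then show "I \<in> (\<Union>i<m. path_block i)" by blast
next
  fix I assume "I \<in> (\<Union>i<m. path_block i)"
  then obtain i a where "i < m" "I = {a..Suc i}" "1 \<le> a" "a \<le> Suc i"
    by (auto simp: path_block_def)
  then show "I \<in> connected_sets m (path_edges m)"
    by (auto simp: connected_sets_def path_edges_iff intro!: induced_connected_atLeastAtMost)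
qed

lemma nice_blocks_path: "nice_blocks {1..m} m path_block"
proof
  show "path_block i \<noteq> {}" for i by (simp add: path_block_def)
  show "I \<subseteq> {1..m}" if "i < m" "I \<in> path_block i" for i I
    using that by (auto simp: path_block_def)
  show "path_block i \<inter> path_block j = {}" if "i \<noteq> j" for i j
    using that by (auto simp: path_block_def Icc_eq_Icc)
  show "c i = 0"
    if h: "\<And>i. i < m \<Longrightarrow> h i \<in> path_block i"
      and c: "\<And>j. j \<in> {1..m} \<Longrightarrow> (\<Sum>i<m. c i * of_bool (j \<in> h i)) = 0"
      and i: "i < m" for h i and c :: "nat \<Rightarrow> rat"
  proof (rule triangular_coefficients[of "{..<m}" Suc h c])
    show "(\<Sum>j\<in>{..<m}. c j * of_bool (Suc i \<in> h j)) = 0" if "i \<in> {..<m}" for i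
      using c[of "Suc i"] that by simp
    show "Suc i \<in> h i" if "i \<in> {..<m}" for i
      using path_blockD(1)[OF h[of i]] that by simp
    show "Suc i \<notin> h j" if "i \<in> {..<m}" "j \<in> {..<m}" "j < i" for i j
      using path_blockD(2)[OF h[of j]] that by auto
  qed (use i in simp_all)
  show "\<exists>i<m. \<exists>J. {K \<in> path_block i. \<forall>x\<in>X. sum x K = 0} = {J}"
    if "i < m" "I \<in> path_block i" "\<forall>x\<in>X. sum x I = 0" for i I and X :: "(nat \<Rightarrow> rat) set"
  proof -
    let ?P = "\<lambda>i. \<exists>I\<in>path_block i. \<forall>x\<in>X. sum x I = 0"
    \<comment> \<open>In the first block that is hit, two hits would differ by an interval with
      smaller right end that also has sum zero.\<close>
    define b where "b = (LEAST i. ?P i)"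
    have "?P i" using that by blast
    then have "?P b" "b \<le> i" unfolding b_def by (rule LeastI, rule Least_le)
    then obtain I where I: "I \<in> path_block b" "\<forall>x\<in>X. sum x I = 0" by blast
    have no_two: False if less: "1 \<le> a" "a < c" "c \<le> Suc b"
      and van: "\<forall>x\<in>X. sum x {a..Suc b} = 0" "\<forall>x\<in>X. sum x {c..Suc b} = 0" for a c
    proof -
      \<comment> \<open>The difference interval ends at c - 1 = d + 1, so it belongs to block
        d.\<close>
      obtain d where d: "c = Suc (Suc d)" using less by (cases c; cases "c - 1") auto
      have "\<forall>x\<in>X. sum x {a..<c} = 0"
        using van sum_atLeastAtMost_split[of a c "Suc b"] less by (metis add.right_neutral less_imp_le)
      moreover have "{a..<c} = {a..Suc d}" using d by auto
      moreover have "{a..Suc d} \<in> path_block d" using less d by (auto simp: path_block_def)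
      ultimately have "?P d" by metis
      then show False using not_less_Least[of d ?P] less d by (simp add: b_def)
    qed
    have "J = K" if JK: "J \<in> path_block b" "K \<in> path_block b"
      "\<forall>x\<in>X. sum x J = 0" "\<forall>x\<in>X. sum x K = 0" for J K
    proof -
      obtain a c where "J = {a..Suc b}" "K = {c..Suc b}" "a \<in> {1..Suc b}" "c \<in> {1..Suc b}"
        using JK(1,2) unfolding path_block_def by blast
      then show ?thesis
        using no_two[of a c] no_two[of c a] JK(3,4) unfolding atLeastAtMost_iff
        by (metis linorder_neqE_nat)
    qed
    then have "{K \<in> path_block b. \<forall>x\<in>X. sum x K = 0} = {I}" using I by blast
    then show ?thesis using \<open>b \<le> i\<close> \<open>i < m\<close> by (meson le_less_trans)
  qed
qed

section \<open>The nice partition of a path with a triangle\<close>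

text \<open>With \<open>t = k + 1\<close>, the prefix sums \<open>s\<^sub>b = x\<^sub>1 + \<dots> + x\<^sub>b\<close>, \<open>u = - x\<^sub>t\<close> and \<open>w = s\<^sub>1 + u\<close>, the forms
  in the blocks are: \<open>s\<^sub>1 - u\<close> in block 0; \<open>u\<close> and all \<open>s\<^sub>b\<close> in block 1; the differences of \<open>s\<^sub>b\<close> with
  \<open>s\<^sub>1, \<dots>, s\<^bsub>b - 1\<^esub>, u, w\<close> in block \<open>b \<ge> 2\<close>.\<close>

definition delta_set :: "nat \<Rightarrow> nat \<Rightarrow> nat \<Rightarrow> nat set" where
  "delta_set k b j = (if j < b then {j + 1..b} else
     if j = b then insert (k + 1) {1..b} else insert (k + 1) {2..b})"

definition delta_block :: "nat \<Rightarrow> nat \<Rightarrow> nat set set" where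
  "delta_block k b = (if b = 0 then {{1, k + 1}} else
     if b = 1 then (\<lambda>c. if c = 0 then {k + 1} else {1..c}) ` {0..k} else
     delta_set k b ` {1..b + 1})"

lemma delta_block_0: "delta_block k 0 = {{1, k + 1}}"
  by (simp add: delta_block_def)

lemma delta_block_1: "delta_block k 1 = (\<lambda>c. if c = 0 then {k + 1} else {1..c}) ` {0..k}"
  by (simp add: delta_block_def)

lemma delta_block_ge_2: "2 \<le> b \<Longrightarrow> delta_block k b = delta_set k b ` {1..b + 1}"
  by (simp add: delta_block_def)

lemma delta_block_ge_2D:
  assumes "2 \<le> b" "b \<le> k" "I \<in> delta_block k b"
  shows "b \<in> I" "I \<subseteq> insert (k + 1) {1..b}"
      "k + 1 \<notin> I \<Longrightarrow> 1 \<notin> I"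
  using assms by (auto simp: delta_block_ge_2 delta_set_def split: if_splits)

lemma connected_sets_delta:
  assumes k: "k \<ge> 2"
  shows "connected_sets (k + 1) (delta_edges k) = (\<Union>i<k + 1. delta_block k i)"
proof (intro equalityI subsetI)
  fix I assume I: "I \<in> connected_sets (k + 1) (delta_edges k)"
  note I' = connected_setsD[OF I]
  show "I \<in> (\<Union>i<k + 1. delta_block k i)"
  proof (cases "k + 1 \<in> I")
    case False
    then have sub: "I \<subseteq> {1..k}" using I'(1) by (auto simp: le_Suc_eq)
    define a b where "a = Min I" and "b = Max I"
    have eq: "I = {a..b}" unfolding a_def b_def
      by (rule induced_connected_interval[OF I'(4,3)]) (use sub in \<open>auto simp: delta_edges_iff\<close>)
    have "a \<in> I" "b \<in> I" "a \<le> b" using I'(2,3) by (auto simp: a_def b_def)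
    then have ab: "1 \<le> a" "a \<le> b" "b \<le> k" using sub by auto
    show ?thesis
    proof (cases "a = 1")
      case True
      have "I \<in> delta_block k 1"
        unfolding delta_block_1 by (rule image_eqI[of _ _ b]) (use eq True ab in auto)
      moreover have "1 < k + 1" using k by simp
      ultimately show ?thesis by blast
    next
      case False
      have "I \<in> delta_block k b"
        unfolding delta_block_def using eq False ab
        by (auto simp: delta_set_def intro!: image_eqI[of _ _ "a - 1"])
      moreover have "b < k + 1" using ab by simp
      ultimately show ?thesis by blast
    qed
  next
    case True
    show ?thesis
    proof (cases "I = {k + 1}")
      case True
      have "I \<in> delta_block k 1"
        unfolding delta_block_1 by (rule image_eqI[of _ _ 0]) (use True in auto)
      moreover have "1 < k + 1" using k by simp
      ultimately show ?thesis by blast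
    next
      case False
      let ?J = "I - {k + 1}"
      define b where "b = Max ?J"
      have fin: "finite ?J" and ne: "?J \<noteq> {}" using I'(3) False True by auto
      have bJ: "b \<in> ?J" using Max_in[OF fin ne] by (simp add: b_def)
      have J_le: "i \<le> b" if "i \<in> ?J" for i using Max_ge[OF fin that] by (simp add: b_def)
      have b: "1 \<le> b" "b \<le> k" "b \<in> I" using bJ I'(1) by (auto simp: le_Suc_eq)
      have fill: "j \<in> I" if j: "2 \<le> j" "j \<le> b" for j
      proof (rule ccontr)
        assume "j \<notin> I"
        \<comment> \<open>The part of \<open>I\<close> above the gap: its vertices are at least 3
          and so not joined to k + 1, and a path edge leaving it downwards would end in the missing
          j.\<close>
        let ?A = "{i \<in> I. j < i \<and> i \<le> k}"
        have "b \<in> ?A" "k + 1 \<notin> ?A" using b j \<open>j \<notin> I\<close> by (auto simp: less_le)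
        then have "?A \<subseteq> I" "?A \<noteq> {}" "?A \<noteq> I" using True by blast+
        then obtain x y where xy: "x \<in> ?A" "y \<in> I - ?A" "{x, y} \<in> delta_edges k"
          by (rule induced_connected_cut[OF I'(4)])
        then have "y = x + 1 \<and> y \<le> k \<or> x = y + 1 \<or> y = k + 1 \<and> x \<le> 2"
          unfolding delta_edges_iff by auto
        moreover have "y \<noteq> j" using xy \<open>j \<notin> I\<close> by auto
        moreover have "y \<le> j \<or> k < y" using xy by auto
        ultimately show False using xy(1) j by auto
      qed
      have "?J \<subseteq> {1..b}"
      proof
        fix i assume "i \<in> ?J"
        then show "i \<in> {1..b}" using J_le[of i] I'(1) by auto
      qed
      moreover have "{2..b} \<subseteq> ?J" using fill b by auto
      moreover have "{1..b} = insert 1 {2..b}" using b by auto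
      ultimately have "?J = {1..b} \<or> 1 \<notin> I \<and> ?J = {2..b}" using b by (cases "1 \<in> I") auto
      then have I_eq: "I = insert (k + 1) {1..b} \<or> 1 \<notin> I \<and> I = insert (k + 1) {2..b}"
        using True by (metis insert_Diff)
      show ?thesis
      proof (cases "b = 1")
        case True
        then have "I = insert (k + 1) {1..1}" using I_eq b(3) by blast
        then have "I \<in> delta_block k 0" by (simp add: delta_block_0 insert_commute)
        then show ?thesis by (intro UN_I[of 0]) simp_all
      next
        case False
        then have "2 \<le> b" using b by simp
        then have "delta_set k b b \<in> delta_block k b"
            "delta_set k b (b + 1) \<in> delta_block k b"
          by (auto simp: delta_block_ge_2)
        then have "I \<in> delta_block k b"
          using I_eq by (auto simp: delta_set_def)
        moreover have "b < k + 1" using b by simp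
        ultimately show ?thesis by blast
      qed
    qed
  qed
next
  fix I assume "I \<in> (\<Union>i<k + 1. delta_block k i)"
  then obtain b where b: "b \<le> k" "I \<in> delta_block k b" by (auto simp: less_Suc_eq_le)
  have Icc: "induced_connected (delta_edges k) {a..c}" if "1 \<le> a" "a \<le> c" "c \<le> k" for a c
    using that by (intro induced_connected_atLeastAtMost) (auto simp: delta_edges_iff)
  have Icc_t: "induced_connected (delta_edges k) (insert (k + 1) {a..c})"
    if "1 \<le> a" "a \<le> 2" "a \<le> c" "c \<le> k" for a c
  proof -
    have "{k + 1, a} \<in> delta_edges k" using that by (auto simp: delta_edges_iff)
    then have "adjacent (delta_edges k) {k + 1} {a..c}"
      using that by (auto simp: adjacent_def)
    then have "induced_connected (delta_edges k) ({k + 1} \<union> {a..c})"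
      using Icc that by (intro induced_connected_Un induced_connected_singleton) auto
    then show ?thesis by simp
  qed
  consider "b = 0" | "b = 1" | "2 \<le> b" by linarith
  then have "induced_connected (delta_edges k) I \<and> I \<subseteq> {1..k + 1}"
  proof cases
    case 1
    then show ?thesis using b Icc_t[of 1 1] k by (auto simp: delta_block_0 insert_commute)
  next
    case 2
    then have "I \<in> (\<lambda>c. if c = 0 then {k + 1} else {1..c}) ` {0..k}"
      using b(2) by (simp only: delta_block_1)
    then obtain c where "c \<le> k" "I = (if c = 0 then {k + 1} else {1..c})"
      unfolding image_iff by (auto simp del: One_nat_def)
    then show ?thesis using Icc[of 1 c] induced_connected_singleton by auto
  next
    case 3
    then obtain j where "1 \<le> j" "j \<le> b + 1" "I = delta_set k b j"
      using b by (auto simp: delta_block_ge_2)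
    then show ?thesis
      using Icc[of "j + 1" b] Icc_t[of 1 b] Icc_t[of 2 b] 3 b
      by (auto simp: delta_set_def split: if_splits)
  qed
  then show "I \<in> connected_sets (k + 1) (delta_edges k)"
    by (simp add: connected_sets_def)
qed

text \<open>If a block \<open>b \<ge> 2\<close> is hit for the least possible \<open>b\<close> and is hit twice, then \<open>s\<^sub>b = w\<close> and one of
  \<open>u\<close>, \<open>s\<^sub>1\<close> vanishes; then block 1 is hit once, or the first \<open>c \<ge> 2\<close> with \<open>s\<^sub>c = 0\<close> gives a block hit
  once.\<close>

lemma delta_unique_coincidence:
  fixes s :: "nat \<Rightarrow> 'a" and u w :: 'a
  assumes s1w: "s 1 = w \<longleftrightarrow> u = s 0" and uw: "u = w \<longleftrightarrow> s 1 = s 0"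
  defines "R1 \<equiv> \<lambda>c. if c = 0 then u = s 0 else s c = s 0"
    and "R \<equiv> \<lambda>b j. if j < b then s b = s j else if j = b then s b = u else s b = w"
  assumes some: "(\<exists>c\<le>k. R1 c) \<or> (\<exists>b\<in>{2..k}. \<exists>j\<in>{1..b + 1}. R b j)" and ne: "s 1 \<noteq> u"
  shows "(\<exists>!c. c \<in> {0..k} \<and> R1 c) \<or> (\<exists>b\<in>{2..k}. \<exists>!j. j \<in> {1..b + 1} \<and> R b j)"
proof -
  have R_cases: "(\<exists>i. 1 \<le> i \<and> i < b \<and> j = i \<and> s b = s i) \<or> j = b \<and> s b = u \<or> j = b + 1 \<and> s b = w"
    if "j \<in> {1..b + 1}" "R b j" for b j
    using that by (auto simp: R_def split: if_splits)
  let ?H = "\<lambda>b. 2 \<le> b \<and> b \<le> k \<and> (\<exists>j\<in>{1..b + 1}. R b j)"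
  have H_s: "?H b" if "2 \<le> b" "b \<le> k" "1 \<le> j" "j < b" "s b = s j" for b j
    using that by (auto simp: R_def intro!: bexI[of _ j])
  have H_u: "?H b" if "2 \<le> b" "b \<le> k" "s b = u" for b
    using that by (auto simp: R_def intro!: bexI[of _ b])
  have H_w: "?H b" if "2 \<le> b" "b \<le> k" "s b = w" for b
    using that by (auto simp: R_def intro!: bexI[of _ "b + 1"])
  have first_zero: ?thesis
    if ex: "\<exists>c\<in>{2..k}. s c = s 0" and two: "u = s 0 \<and> s 1 = w \<or> s 1 = s 0 \<and> u = w"
  proof -
    define c where "c = (LEAST c. c \<in> {2..k} \<and> s c = s 0)"
    have c: "c \<in> {2..k}" "s c = s 0"
      using ex LeastI_ex[of "\<lambda>c. c \<in> {2..k} \<and> s c = s 0"] unfolding c_def by blast+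
    have least: "s j \<noteq> s 0" if "2 \<le> j" "j < c" for j
      using not_less_Least[of j "\<lambda>c. c \<in> {2..k} \<and> s c = s 0"] that c(1) by (auto simp: c_def)
    \<comment> \<open>The one coincidence of s_c = 0: with u if u = 0, and with s_1 if s_1 = 0.
      Minimality of c and the inequality of s_1 and u rule out the rest.\<close>
    define j where "j = (if u = s 0 then c else 1)"
    have "i = j" if "i \<in> {1..c + 1}" "R c i" for i
      using R_cases[OF that] two ne c least unfolding j_def
      by (metis One_nat_def Suc_1 Suc_leI le_neq_implies_less)
    moreover have "j \<in> {1..c + 1}" "R c j"
      using two ne c by (auto simp: j_def R_def)
    ultimately have "\<exists>!j. j \<in> {1..c + 1} \<and> R c j" by blast
    then show ?thesis using c(1) by blast
  qed
  show ?thesis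
  proof (cases "\<exists>b. ?H b")
    case False
    then obtain c where c: "c \<le> k" "R1 c" using some by fastforce
    \<comment> \<open>Two vanishing forms in block 1 coincide with each other; since s_1 and u
      differ, this hits a block b with b at least 2, which the present case excludes.\<close>
    have no_two: False if "R1 a" "R1 c" "a < c" "c \<le> k" for a c
    proof (cases "a = 0")
      case True
      then have "s c = u" "c \<noteq> 0" using that by (auto simp: R1_def)
      then show False using ne H_u[of c] that(4) \<open>\<not> (\<exists>b. ?H b)\<close>
        by (metis One_nat_def Suc_1 Suc_leI bot_nat_0.not_eq_extremum le_neq_implies_less)
    next
      case 2: False
      then have "s c = s a" using that by (auto simp: R1_def)
      then show False using H_s[of c a] that(3,4) 2 \<open>\<not> (\<exists>b. ?H b)\<close> by auto
    qed
    have "c' = c" if "c' \<in> {0..k}" "R1 c'" for c'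
      using no_two[of c c'] no_two[of c' c] c that by (metis atLeastAtMost_iff linorder_neqE_nat)
    then show ?thesis using c by (metis atLeastAtMost_iff zero_le)
  next
    case True
    define b where "b = (LEAST b. ?H b)"
    have b: "?H b" unfolding b_def using True by (rule LeastI_ex)
    have least: "\<not> ?H j" if "j < b" for j
      using that unfolding b_def by (rule not_less_Least)
    obtain j where j: "j \<in> {1..b + 1}" "R b j" using b by blast
    show ?thesis
    proof (cases "\<exists>i. i \<in> {1..b + 1} \<and> R b i \<and> i \<noteq> j")
      case False
      then have "\<exists>!j. j \<in> {1..b + 1} \<and> R b j" using j by blast
      then show ?thesis using b by auto
    next
      case True
      then obtain i i' where ii': "i \<in> {1..b + 1}" "R b i" "i' \<in> {1..b + 1}" "R b i'"
          "i < i'"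
        using j by (metis linorder_neqE_nat)
      \<comment> \<open>Otherwise s_b = s_l with l at least 2, and the second hit i' then gives a
        coincidence in block l or block i', before the first block that is hit.\<close>
      have low: "i = 1 \<and> s b = s 1 \<or> i = b \<and> s b = u"
        using R_cases[OF ii'(1,2)]
      proof (elim disjE exE conjE)
        fix l assume l: "1 \<le> l" "l < b" "i = l" "s b = s l"
        have "l < 2"
        proof (rule ccontr)
          assume "\<not> l < 2"
          then have "?H i' \<or> ?H l"
            using R_cases[OF ii'(3,4)] ii'(5) l b H_s[of i' l] H_u[of l] H_w[of l] by auto
          moreover have "i' < b" if "?H i'" "\<not> ?H l"
            using R_cases[OF ii'(3,4)] l b H_u[of l] H_w[of l] that \<open>\<not> l < 2\<close> by auto
          ultimately show False using least l(2) by blast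
        qed
        then have "l = 1" using l by simp
        then show ?thesis using l by simp
      qed (use ii' in auto)
      \<comment> \<open>If s_b = s_1, the second hit can only be w, so s_1 = w and u = 0. If s_b =
        u, the second hit is again w, so u = w and s_1 = 0.\<close>
      have two: "u = s 0 \<and> s 1 = w \<or> s 1 = s 0 \<and> u = w"
        using low
      proof (elim disjE conjE)
        assume i: "i = 1" "s b = s 1"
        show ?thesis
          using R_cases[OF ii'(3,4)]
        proof (elim disjE exE conjE)
          fix l assume l: "1 \<le> l" "l < b" "i' = l" "s b = s l"
          then have "?H l" using H_s[of l 1] i ii'(5) b by auto
          then show ?thesis using least l(2) by blast
        qed (use i ne s1w in auto)
      next
        assume i: "i = b" "s b = u"
        then show ?thesis using R_cases[OF ii'(3,4)] ii'(5) uw by auto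
      qed
      show ?thesis
      proof (cases "\<exists>c\<in>{2..k}. s c = s 0")
        case True
        then show ?thesis using first_zero two by blast
      next
        case False
        \<comment> \<open>With no zero among s_2, ..., s_k, block 1 is hit only by u or only by s_1;
          both cannot vanish because they differ.\<close>
        define c :: nat where "c = (if u = s 0 then 0 else 1)"
        have "c \<in> {0..k}" "R1 c" using two b by (auto simp: c_def R1_def)
        moreover have "c' = c" if c': "c' \<in> {0..k}" "R1 c'" for c'
        proof -
          have "c' \<notin> {2..k}" using False c' by (auto simp: R1_def)
          then have "c' = 0 \<or> c' = 1" using c' by auto
          then show ?thesis using c' two ne by (auto simp: c_def R1_def)
        qed
        ultimately show ?thesis by blast
      qed
    qed
  qed
qed

lemma sum_delta_set:
  fixes x :: "nat \<Rightarrow> rat"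
  assumes b: "2 \<le> b" "b \<le> k"
  shows "sum x (delta_set k b j) = sum x {1..b} -
    (if j < b then sum x {1..j} else if j = b then - x (k + 1) else x 1 - x (k + 1))"
proof -
  have "sum x {1..b} = sum x {1..<j + 1} + sum x {j + 1..b}" if "j < b"
    using that by (intro sum_atLeastAtMost_split) auto
  moreover have "{1..<j + 1} = {1..j}" by auto
  moreover have "sum x {1..b} = sum x {1..<2} + sum x {2..b}"
    using b by (intro sum_atLeastAtMost_split) auto
  moreover have "{1..<2} = {1 :: nat}" by auto
  moreover have "sum x (insert (k + 1) {a..b}) = x (k + 1) + sum x {a..b}" for a
    using b by (intro sum.insert) auto
  ultimately show ?thesis unfolding delta_set_def by (simp del: One_nat_def)
qed

text \<open>The common zero has \<open>s\<^sub>1 = u = 1\<close>; every further \<open>s\<^sub>b\<close> is then one of the positive numbers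
  \<open>s\<^sub>1, \<dots>, s\<^bsub>b - 1\<^esub>, u = 1, w = 2\<close>.\<close>

lemma delta_blocks_positive_zero:
  assumes k: "k \<ge> 2" and h: "\<And>b. b \<in> {2..k} \<Longrightarrow> h b \<in> delta_block k b"
  shows "\<exists>x :: nat \<Rightarrow> rat. x (k + 1) = - 1 \<and> x 1 = 1 \<and>
    (\<forall>b\<in>{1..k}. sum x {1..b} > 0) \<and> (\<forall>b\<in>{2..k}. sum x (h b) = 0)"
proof -
  have "\<exists>x :: nat \<Rightarrow> rat. x (k + 1) = - 1 \<and> x 1 = 1 \<and> (\<forall>b\<in>{1..l}. sum x {1..b} > 0) \<and>
    (\<forall>b\<in>{2..l}. sum x (h b) = 0)" if "1 \<le> l" "l \<le> k" for l
    using that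
  proof (induction l rule: dec_induct)
    case base
    show ?case using k by (intro exI[of _ "\<lambda>i. if i = 1 then 1 else - 1"]) auto
  next
    case (step l)
    then obtain x :: "nat \<Rightarrow> rat" where x: "x (k + 1) = - 1" "x 1 = 1"
      "\<And>b. b \<in> {1..l} \<Longrightarrow> sum x {1..b} > 0"
          "\<And>b. b \<in> {2..l} \<Longrightarrow> sum x (h b) = 0"
      by auto
    have l: "2 \<le> Suc l" "Suc l \<le> k" using step by auto
    note hl = h[unfolded atLeastAtMost_iff, OF conjI, OF l]
    \<comment> \<open>Coordinate l + 1 occurs in the set chosen from block l + 1 and in none chosen
      from blocks 2..l, so it can be adjusted to make the new form vanish without disturbing the
      earlier ones.\<close>
    define y where "y = x(Suc l := - sum x (h (Suc l) - {Suc l}))"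
    have keep: "sum y A = sum x A" if "Suc l \<notin> A" for A
      using that by (intro sum.cong) (auto simp: y_def)
    have y: "y (k + 1) = - 1" "y 1 = 1" using x l step by (auto simp: y_def)
    have old_pos: "sum y {1..b} > 0" if "b \<in> {1..l}" for b
      using keep[of "{1..b}"] x(3)[OF that] that by auto
    have old_zero: "sum y (h b) = 0" if b: "b \<in> {2..l}" for b
    proof -
      have "h b \<subseteq> insert (k + 1) {1..b}"
        using b l by (intro delta_block_ge_2D(2)[OF _ _ h]) auto
      then have "Suc l \<notin> h b" using b l by auto
      then show ?thesis using keep x(4)[OF b] by simp
    qed
    have "Suc l \<in> h (Suc l)" and sub: "h (Suc l) \<subseteq> insert (k + 1) {1..Suc l}"
      using delta_block_ge_2D(1,2)[OF l hl] by auto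
    moreover have "finite (h (Suc l))" using sub finite_subset by blast
    ultimately have "sum y (h (Suc l)) = y (Suc l) + sum y (h (Suc l) - {Suc l})"
      by (simp add: sum.remove)
    then have new_zero: "sum y (h (Suc l)) = 0"
      using keep[of "h (Suc l) - {Suc l}"] by (simp add: y_def)
    obtain j where j: "j \<in> {1..Suc l + 1}" "h (Suc l) = delta_set k (Suc l) j"
      using hl delta_block_ge_2[OF l(1)] by auto
    have new_pos: "sum y {1..Suc l} > 0"
    proof -
      have "sum y {1..Suc l} = (if j < Suc l then sum y {1..j} else
          if j = Suc l then - y (k + 1) else y 1 - y (k + 1))"
        using new_zero sum_delta_set[OF l, of y j] j(2) by simp
      moreover have "sum y {1..j} > 0" if "j < Suc l" using old_pos[of j] j(1) that by auto
      ultimately show ?thesis using y by (simp split: if_splits)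
    qed
    have "sum y {1..b} > 0" if "b \<in> {1..Suc l}" for b
      using old_pos[of b] new_pos that by (cases "b = Suc l") auto
    moreover have "sum y (h b) = 0" if "b \<in> {2..Suc l}" for b
      using old_zero[of b] new_zero that by (cases "b = Suc l") auto
    ultimately show ?case using y by blast
  qed
  from this[of k] k show ?thesis by simp
qed

lemma ex1_image:
  assumes "\<exists>!j. j \<in> J \<and> R j" and "\<And>j. j \<in> J \<Longrightarrow> R j \<longleftrightarrow> S (g j)"
  shows "\<exists>I. {K \<in> g ` J. S K} = {I}"
proof -
  obtain j where j: "j \<in> J" "R j" "\<And>i. i \<in> J \<Longrightarrow> R i \<Longrightarrow> i = j" using assms(1) by metis
  have "{K \<in> g ` J. S K} = {g j}" using j assms(2) by blast
  then show ?thesis by blast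
qed

text \<open>For independence, a common zero of the forms chosen outside block 1 annihilates every
  term of a relation except that of block 1, where the chosen form is nonzero by positivity. Once
  this term is gone, the remaining sets are triangular.\<close>

lemma nice_blocks_delta:
  assumes k: "k \<ge> 2"
  shows "nice_blocks {1..k + 1} (k + 1) (delta_block k)"
proof
  have ge_2: "2 \<le> i" if "i \<noteq> 0" "i \<noteq> 1" for i :: nat using that by simp
  show "delta_block k i \<noteq> {}" for i by (simp add: delta_block_def)
  show "I \<subseteq> {1..k + 1}" if "i < k + 1" "I \<in> delta_block k i" for i I
  proof -
    have "I \<in> connected_sets (k + 1) (delta_edges k)"
      using that connected_sets_delta[OF k] by blast
    then show ?thesis by (rule connected_setsD(1))
  qed
  show "delta_block k i \<inter> delta_block k j = {}" if ij: "i < k + 1" "j < k + 1" "i \<noteq> j" for i j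
  proof -
    \<comment> \<open>Disjointness is shown by reading the block number off the set itself.\<close>
    define col where "col I = (if I = {1, k + 1} then 0 else
      if I = {k + 1} \<or> k + 1 \<notin> I \<and> 1 \<in> I then 1 else Max (I - {k + 1}))" for I
    have "col I = i" if i: "i < k + 1" "I \<in> delta_block k i" for i I
    proof -
      consider "i = 0" | "i = 1" | "2 \<le> i" by linarith
      then show ?thesis
      proof cases
        case 1
        then show ?thesis using i by (simp add: delta_block_0 col_def)
      next
        case 2
        then have "I \<in> (\<lambda>c. if c = 0 then {k + 1} else {1..c}) ` {0..k}"
          using i(2) by (simp only: delta_block_1)
        then obtain c where c: "c \<le> k" "I = (if c = 0 then {k + 1} else {1..c})"
          unfolding image_iff by (auto simp del: One_nat_def)
        have "I \<noteq> {1, k + 1} \<and> (I = {k + 1} \<or> k + 1 \<notin> I \<and> 1 \<in> I)"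
        proof (cases "c = 0")
          case True
          then show ?thesis using c k by auto
        next
          case False
          then have "k + 1 \<notin> I" "1 \<in> I" using c by auto
          then show ?thesis by blast
        qed
        then show ?thesis using 2 by (simp add: col_def)
      next
        case 3
        have D: "i \<in> I" "I \<subseteq> insert (k + 1) {1..i}"
            "k + 1 \<notin> I \<Longrightarrow> 1 \<notin> I"
          using delta_block_ge_2D[OF 3 _ i(2)] i(1) by auto
        have iI: "i \<in> I - {k + 1}" using D(1) i(1) by auto
        have "I \<noteq> {1, k + 1}" "I \<noteq> {k + 1}" using iI 3 by auto
        moreover have "Max (I - {k + 1}) = i"
        proof (rule Max_eqI)
          show "finite (I - {k + 1})" using D(2) finite_subset by blast
          show "y \<le> i" if "y \<in> I - {k + 1}" for y using D(2) that by auto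
        qed (rule iI)
        ultimately show ?thesis using D(3) by (auto simp: col_def)
      qed
    qed
    then show ?thesis using ij by blast
  qed
  show "c i = 0"
    if h: "\<And>i. i < k + 1 \<Longrightarrow> h i \<in> delta_block k i"
      and c: "\<And>j. j \<in> {1..k + 1} \<Longrightarrow> (\<Sum>i<k + 1. c i * of_bool (j \<in> h i)) = 0"
      and i: "i < k + 1" for h i and c :: "nat \<Rightarrow> rat"
  proof -
    have h_sub: "h i \<subseteq> {1..k + 1}" if "i < k + 1" for i
    proof -
      have "h i \<in> connected_sets (k + 1) (delta_edges k)"
        using h[OF that] that connected_sets_delta[OF k] by blast
      then show ?thesis by (rule connected_setsD(1))
    qed
    have h_ge_2: "h b \<in> delta_block k b" if "b \<in> {2..k}" for b using h that by simp
    obtain x :: "nat \<Rightarrow> rat" where x: "x (k + 1) = - 1" "x 1 = 1"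
      "\<And>b. b \<in> {1..k} \<Longrightarrow> sum x {1..b} > 0"
          "\<And>b. b \<in> {2..k} \<Longrightarrow> sum x (h b) = 0"
      using delta_blocks_positive_zero[of k h, OF k h_ge_2] by blast
    have h0: "h 0 = {1, k + 1}" using h[of 0] by (simp add: delta_block_0)
    have x0: "sum x (h 0) = 0" using x(1,2) k unfolding h0 by simp
    have x1: "sum x (h 1) \<noteq> 0"
    proof -
      have "h 1 \<in> (\<lambda>c. if c = 0 then {k + 1} else {1..c}) ` {0..k}"
        using h[of 1] k unfolding delta_block_1 by simp
      then obtain a where a: "a \<le> k" "h 1 = (if a = 0 then {k + 1} else {1..a})"
        unfolding image_iff by (auto simp del: One_nat_def)
      then show ?thesis using x(1) x(3)[of a] by (cases "a = 0") auto
    qed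
    \<comment> \<open>The coordinate equations of the relation are weighted by x and added up;
      exchanging the sums turns them into one equation between the values of the forms at x.\<close>
    have "(\<Sum>i<k + 1. c i * sum x (h i)) = (\<Sum>i<k + 1. \<Sum>j\<in>{1..k + 1}. c i * of_bool (j \<in> h i) * x j)"
    proof (rule sum.cong)
      fix i assume "i \<in> {..<k + 1}"
      then have "sum x (h i) = sum x ({1..k + 1} \<inter> h i)"
        using h_sub[of i] by (simp only: lessThan_iff Int_absorb1)
      also have "\<dots> = (\<Sum>j\<in>{1..k + 1}. if j \<in> h i then x j else 0)"
        by (rule sum.inter_restrict) simp
      also have "\<dots> = (\<Sum>j\<in>{1..k + 1}. of_bool (j \<in> h i) * x j)"
        by (rule sum.cong) auto
      finally show "c i * sum x (h i) = (\<Sum>j\<in>{1..k + 1}. c i * of_bool (j \<in> h i) * x j)"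
        by (simp only: sum_distrib_left mult.assoc)
    qed simp
    also have "\<dots> = (\<Sum>j\<in>{1..k + 1}. (\<Sum>i<k + 1. c i * of_bool (j \<in> h i)) * x j)"
      by (subst sum.swap) (simp only: sum_distrib_right)
    also have "\<dots> = 0"
    proof (rule sum.neutral, rule ballI)
      fix j assume "j \<in> {1..k + 1}"
      from c[OF this] show "(\<Sum>i<k + 1. c i * of_bool (j \<in> h i)) * x j = 0" by (simp only: mult_zero_left)
    qed
    finally have total: "(\<Sum>i<k + 1. c i * sum x (h i)) = 0" .
    have "(\<Sum>i\<in>{..<k + 1} - {1}. c i * sum x (h i)) = 0"
    proof (rule sum.neutral, rule ballI)
      fix i assume "i \<in> {..<k + 1} - {1}"
      then have "i = 0 \<or> i \<in> {2..k}" by auto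
      then show "c i * sum x (h i) = 0" using x0 x(4) by auto
    qed
    then have "c 1 * sum x (h 1) = 0"
      using total sum.remove[of "{..<k + 1}" 1 "\<lambda>i. c i * sum x (h i)"] k by simp
    then have c1: "c 1 = 0" using x1 by simp
    show ?thesis
    proof (cases "i = 1")
      case False
      let ?L = "{..<k + 1} - {1}"
      \<comment> \<open>Block 0 consists of the set {1, k + 1}, so vertex 1 is its pivot; with block
        1 removed, vertex b is the pivot of each later block b.\<close>
      define \<tau> where "\<tau> i = (if i = 0 then 1 else i)" for i :: nat
      show ?thesis
      proof (rule triangular_coefficients[of ?L \<tau> h c])
        show "i \<in> ?L" using i False by simp
        show "finite ?L" by simp
        show "\<tau> i \<in> h i" if "i \<in> ?L" for i
          using that h0 delta_block_ge_2D(1)[OF ge_2[of i] _ h[of i]] by (cases "i = 0") (auto simp: \<tau>_def)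
        show "\<tau> i \<notin> h j" if "i \<in> ?L" "j \<in> ?L" "j < i" for i j
        proof (cases "j = 0")
          case True
          then show ?thesis using that h0 by (auto simp: \<tau>_def)
        next
          case False
          then have "h j \<subseteq> insert (k + 1) {1..j}"
            using that by (intro delta_block_ge_2D(2)[OF ge_2 _ h]) auto
          then show ?thesis using that by (auto simp: \<tau>_def)
        qed
        show "(\<Sum>j\<in>?L. c j * of_bool (\<tau> i \<in> h j)) = 0" if "i \<in> ?L" for i
          using c[of "\<tau> i"] that c1 k sum.remove[of "{..<k + 1}" 1 "\<lambda>j. c j * of_bool (\<tau> i \<in> h j)"]
          by (auto simp: \<tau>_def)
      qed
    qed (use c1 in simp)
  qed
  show "\<exists>i<k + 1. \<exists>J. {K \<in> delta_block k i. \<forall>x\<in>X. sum x K = 0} = {J}"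
    if i: "i < k + 1" and I: "I \<in> delta_block k i" "\<forall>x\<in>X. sum x I = 0"
    for i I and X :: "(nat \<Rightarrow> rat) set"
  proof -
    let ?van = "\<lambda>I. \<forall>x\<in>X. sum x I = 0"
    \<comment> \<open>Cut off to 0 outside \<open>X\<close>, these functions are equal exactly when
      the corresponding differences vanish on \<open>X\<close>. The vanishing of forms thus becomes
      the pattern of equalities treated in \<open>delta_unique_coincidence\<close>.\<close>
    define s where "s j = (\<lambda>x :: nat \<Rightarrow> rat. if x \<in> X then sum x {1..j} else 0)" for j :: nat
    define u where "u = (\<lambda>x :: nat \<Rightarrow> rat. if x \<in> X then - x (k + 1) else 0)"
    define w where "w = (\<lambda>x :: nat \<Rightarrow> rat. if x \<in> X then x 1 - x (k + 1) else 0)"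
    define g where "g c = (if c = 0 then {k + 1} else {1..c})" for c :: nat
    let ?R1 = "\<lambda>c. if c = 0 then u = s 0 else s c = s 0"
    let ?R = "\<lambda>b j. if j < b then s b = s j else if j = b then s b = u else s b = w"
    have eqs: "s a = s b \<longleftrightarrow> (\<forall>x\<in>X. sum x {1..a} = sum x {1..b})"
      "s a = u \<longleftrightarrow> (\<forall>x\<in>X. sum x {1..a} = - x (k + 1))"
      "s a = w \<longleftrightarrow> (\<forall>x\<in>X. sum x {1..a} = x 1 - x (k + 1))"
      "u = s a \<longleftrightarrow> (\<forall>x\<in>X. sum x {1..a} = - x (k + 1))"
      "u = w \<longleftrightarrow> (\<forall>x\<in>X. x 1 = 0)" for a b
      by (auto simp: s_def u_def w_def fun_eq_iff)
    have block_1: "delta_block k 1 = g ` {0..k}" unfolding delta_block_1 g_def ..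
    have van_1: "?R1 c \<longleftrightarrow> ?van (g c)" for c
      by (cases "c = 0") (auto simp: eqs g_def)
    have van_b: "?R b j \<longleftrightarrow> ?van (delta_set k b j)" if "b \<in> {2..k}" for b j
      using that by (simp add: sum_delta_set eqs)
    have van_0: "s 1 = u \<longleftrightarrow> ?van {1, k + 1}"
      using k by (auto simp: eqs add_eq_0_iff)
    show ?thesis
    proof (cases "s 1 = u")
      case True
      then have "{K \<in> delta_block k 0. ?van K} = {{1, k + 1}}"
        using van_0 unfolding delta_block_0 by blast
      then show ?thesis by (intro exI[of _ 0] conjI exI) simp_all
    next
      case False
      have "(\<exists>c\<le>k. ?R1 c) \<or> (\<exists>b\<in>{2..k}. \<exists>j\<in>{1..b + 1}. ?R b j)"
      proof -
        consider "i = 0" | "i = 1" | "i \<in> {2..k}" using i by fastforce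
        then show ?thesis
        proof cases
          case 1
          then have "I = {1, k + 1}" using I(1) delta_block_0 by simp
          then show ?thesis using I(2) van_0 False by blast
        next
          case 2
          then obtain c where "c \<le> k" "I = g c" using I(1) block_1 by auto
          then show ?thesis using I(2) van_1[of c] by blast
        next
          case 3
          then obtain j where "j \<in> {1..i + 1}" "I = delta_set k i j"
            using I(1) delta_block_ge_2[of i k] by auto
          then show ?thesis using I(2) van_b[OF 3, of j] 3 by blast
        qed
      qed
      moreover have "s 1 = w \<longleftrightarrow> u = s 0" "u = w \<longleftrightarrow> s 1 = s 0" by (auto simp: eqs)
      ultimately consider "\<exists>!c. c \<in> {0..k} \<and> ?R1 c"
        | b where "b \<in> {2..k}" "\<exists>!j. j \<in> {1..b + 1} \<and> ?R b j"
        using delta_unique_coincidence[of s w u k] False by blast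
      then show ?thesis
      proof cases
        case 1
        then have "\<exists>J. {K \<in> delta_block k 1. ?van K} = {J}"
          unfolding block_1 using van_1 by (rule ex1_image)
        then show ?thesis using k by (intro exI[of _ 1] conjI) auto
      next
        case (2 b)
        then have "\<exists>J. {K \<in> delta_set k b ` {1..b + 1}. ?van K} = {J}"
          using van_b[OF 2(1)] by (intro ex1_image)
        then have "\<exists>J. {K \<in> delta_block k b. ?van K} = {J}"
          using 2(1) by (simp add: delta_block_ge_2)
        then show ?thesis using 2(1) by (intro exI[of _ b] conjI) auto
      qed
    qed
  qed
qed

section \<open>Assembling the two directions\<close>

text \<open>The two notions map in opposite directions between graph and model, so each is obtained
  from the inverse bijection of the other.\<close>

lemma graph_iso_iff_parametrizes:
  "graph_iso n E m F \<longleftrightarrow> (\<exists>p. parametrizes E {1..n} p m F)"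
proof
  assume "graph_iso n E m F"
  then obtain f where f: "bij_betw f {1..n} {1..m}"
    "\<And>a b. a \<in> {1..n} \<Longrightarrow> b \<in> {1..n} \<Longrightarrow> {a, b} \<in> E \<longleftrightarrow> {f a, f b} \<in> F"
    unfolding graph_iso_def by blast
  let ?p = "inv_into {1..n} f"
  have bij: "bij_betw ?p {1..m} {1..n}" by (rule bij_betw_inv_into[OF f(1)])
  have "f (?p i) = i" "?p i \<in> {1..n}" if "i \<in> {1..m}" for i
    using bij_betw_inv_into_right[OF f(1) that] bij_betwE[OF bij] that by blast+
  then have "parametrizes E {1..n} ?p m F"
    using bij f(2) unfolding parametrizes_def by simp
  then show "\<exists>p. parametrizes E {1..n} p m F" by blast
next
  assume "\<exists>p. parametrizes E {1..n} p m F"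
  then obtain p where p: "parametrizes E {1..n} p m F" by blast
  then have bp: "bij_betw p {1..m} {1..n}" by (simp add: parametrizes_def)
  let ?f = "inv_into {1..m} p"
  have bij: "bij_betw ?f {1..n} {1..m}" by (rule bij_betw_inv_into[OF bp])
  have "p (?f a) = a" "?f a \<in> {1..m}" if "a \<in> {1..n}" for a
    using bij_betw_inv_into_right[OF bp that] bij_betwE[OF bij] that by blast+
  then have "{a, b} \<in> E \<longleftrightarrow> {?f a, ?f b} \<in> F" if "a \<in> {1..n}" "b \<in> {1..n}" for a b
    using parametrizes_edge[OF p, of "?f a" "?f b"] that by simp
  then show "graph_iso n E m F" unfolding graph_iso_def using bij by blast
qed

theorem theorem8p10:
  fixes n :: nat and E :: "nat set set"
  assumes "n \<ge> 1"
    and "simple_graph n E"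
    and "induced_connected E {1..n}"
  shows "factored n (conn_subgraph_arr n E) \<longleftrightarrow>
         (graph_iso n E n (path_edges n) \<or>
          (\<exists>k\<ge>2. graph_iso n E (k + 1) (delta_edges k)))"
proof
  assume factored: "factored n (conn_subgraph_arr n E)"
  have "{v} \<notin> E" for v
    using assms(2) unfolding simple_graph_def by (metis doubleton_eq_iff insert_absorb2)
  from factored_imp_rank2_coloring[OF factored this]
  obtain col where "rank2_coloring E {1..n} col" .
  from rank2_coloring.path_or_delta[OF this assms(3)]
  consider p m where "parametrizes E {1..n} p m (path_edges m)"
    | p k where "k \<ge> 2" "parametrizes E {1..n} p (k + 1) (delta_edges k)"
    by auto
  then show "graph_iso n E n (path_edges n) \<or> (\<exists>k\<ge>2. graph_iso n E (k + 1) (delta_edges k))"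
  proof cases
    case (1 p m)
    then have "bij_betw p {1..m} {1..n}" by (simp add: parametrizes_def)
    then have "m = n" using bij_betw_same_card by fastforce
    then show ?thesis using 1 graph_iso_iff_parametrizes by blast
  next
    case (2 p k)
    then show ?thesis using graph_iso_iff_parametrizes by blast
  qed
next
  assume "graph_iso n E n (path_edges n) \<or> (\<exists>k\<ge>2. graph_iso n E (k + 1) (delta_edges k))"
  then show "factored n (conn_subgraph_arr n E)"
  proof (elim disjE exE conjE)
    assume "graph_iso n E n (path_edges n)"
    then obtain p where p: "parametrizes E {1..n} p n (path_edges n)"
      using graph_iso_iff_parametrizes by blast
    show ?thesis
      by (rule nice_blocks_imp_factored_graph[OF p nice_blocks_path connected_sets_path])
  next
    fix k assume k: "2 \<le> k" and "graph_iso n E (k + 1) (delta_edges k)"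
    then obtain p where p: "parametrizes E {1..n} p (k + 1) (delta_edges k)"
      using graph_iso_iff_parametrizes by blast
    show ?thesis
      by (rule nice_blocks_imp_factored_graph[OF p nice_blocks_delta[OF k] connected_sets_delta[OF k]])
  qed
qed

end
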